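(* Let $\varphi\colon F\rightarrowtail G$ be a monomorphism of groups. Then there is an adjoint triple of functors $(\bullet_{(\!(\varphi)\!)},\bullet^{(\varphi)},\bullet_{(\varphi)})$, i.e. $\bullet_{(\!(\varphi)\!)}\colon\mathsf{Ann}^G\to\mathsf{Ann}^F$ is left adjoint to $\bullet^{(\varphi)}\colon\mathsf{Ann}^F\to\mathsf{Ann}^G$, and $\bullet^{(\varphi)}$ is left adjoint to $\bullet_{(\varphi)}\colon\mathsf{Ann}^G\to\mathsf{Ann}^F$. The unit of the first adjunction is $\alpha_\varphi\colon\mathrm{Id}_{\mathsf{Ann}^G}\twoheadrightarrow(\bullet_{(\!(\varphi)\!)})^{(\varphi)}$ and its counit is the identity $(\bullet^{(\varphi)})_{(\!(\varphi)\!)}\to\mathrm{Id}_{\mathsf{Ann}^F}$; the unit of the second adjunction is the identity $\mathrm{Id}_{\mathsf{Ann}^F}\to(\bullet^{(\varphi)})_{(\varphi)}$ and its counit is the canonical inclusion $(\bullet_{(\varphi)})^{(\varphi)}\hookrightarrow\mathrm{Id}_{\mathsf{Ann}^G}$.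
   Context: Groups are commutative and written additively; rings are commutative with $1$. For a group $G$, a $G$-graded ring is a ring $R$ with a family $(R_g)_{g\in G}$ of additive subgroups whose direct sum is $R$ and with $R_gR_h\subseteq R_{g+h}$. Morphisms of $G$-graded rings are ring morphisms $u\colon R\to S$ with $u(R_g)\subseteq S_g$ for all $g$; this gives the category $\mathsf{Ann}^G$. Let $\varphi\colon F\rightarrowtail G$ be a monomorphism of groups. - $\varphi$-restriction: for a $G$-graded ring $R$, $R_{(\varphi)}$ is the subring $\bigoplus_{f\in F}R_{\varphi(f)}$ of $R$ with the $F$-graduation $(R_{\varphi(f)})_{f\in F}$; morphisms are restricted. - $\varphi$-extension: for an $F$-graded ring $S$, $S^{(\varphi)}$ is the ring $S$ with the $G$-graduation $(S^{(\varphi)})_{\varphi(f)}=S_f$ for $f\in F$ and $(S^{(\varphi)})_g=0$ for $g\in G\setminus\mathrm{Im}(\varphi)$; morphisms are unchanged. - $\varphi$-corestriction: for a $G$-graded ring $R$, let $\mathfrak a_\varphi(R)$ be the (graded) ideal of $R$ generated by $\bigcup_{g\in G\setminus\mathrm{Im}(\varphi)}R_g$, and $R_{(\!(\varphi)\!)}:=(R/\mathfrak a_\varphi(R))_{(\varphi)}$, whose underlying ring is $R/\mathfrak a_\varphi(R)$; morphisms are the induced ones. For an $F$-graded ring $S$ one has $(S^{(\varphi)})_{(\varphi)}=S=(S^{(\varphi)})_{(\!(\varphi)\!)}$ (up to the canonical identification $S/0=S$). For a $G$-graded ring $R$, $(R_{(\varphi)})^{(\varphi)}$ is a $G$-graded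 subring of $R$, which gives the natural inclusion $(R_{(\varphi)})^{(\varphi)}\hookrightarrow R$. The natural surjective morphism of $G$-graded rings $\alpha_\varphi(R)\colon R\twoheadrightarrow(R_{(\!(\varphi)\!)})^{(\varphi)}$ is zero in degrees $g\notin\mathrm{Im}(\varphi)$, and in degrees $g\in\mathrm{Im}(\varphi)$ it is the canonical projection $R_g\twoheadrightarrow R_g/\sum_{h\in G\setminus\mathrm{Im}(\varphi)}R_hR_{g-h}$ (that is, it is the canonical projection $R\to R/\mathfrak a_\varphi(R)$). *)

theory Defs
  imports "HOL-Algebra.Weak_Morphisms"
begin

section \<open>Categories, functors and adjunctions\<close>

text \<open>Hom-sets of different pairs of objects need not be disjoint, so composition takes the three
  objects involved as arguments: \<open>comp C a b c v u\<close> is the composite of \<open>u : a \<rightarrow> b\<close> and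
  \<open>v : b \<rightarrow> c\<close>. For the same reason the action of a functor on a morphism takes its domain and
  codomain as arguments.\<close>

record ('o, 'm) category =
  obj :: "'o set"
  hom_set :: "'o \<Rightarrow> 'o \<Rightarrow> 'm set"
  ident :: "'o \<Rightarrow> 'm"
  comp :: "'o \<Rightarrow> 'o \<Rightarrow> 'o \<Rightarrow> 'm \<Rightarrow> 'm \<Rightarrow> 'm"

definition is_category :: "('o, 'm) category \<Rightarrow> bool" where
  "is_category C \<longleftrightarrow>
     (\<forall>a\<in>obj C. ident C a \<in> hom_set C a a) \<and>
     (\<forall>a\<in>obj C. \<forall>b\<in>obj C. \<forall>c\<in>obj C. \<forall>u\<in>hom_set C a b. \<forall>v\<in>hom_set C b c.
        comp C a b c v u \<in> hom_set C a c) \<and>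
     (\<forall>a\<in>obj C. \<forall>b\<in>obj C. \<forall>u\<in>hom_set C a b.
        comp C a a b u (ident C a) = u \<and> comp C a b b (ident C b) u = u) \<and>
     (\<forall>a\<in>obj C. \<forall>b\<in>obj C. \<forall>c\<in>obj C. \<forall>d\<in>obj C.
        \<forall>u\<in>hom_set C a b. \<forall>v\<in>hom_set C b c. \<forall>w\<in>hom_set C c d.
          comp C a b d (comp C b c d w v) u = comp C a c d w (comp C a b c v u))"

record ('o1, 'm1, 'o2, 'm2) functor_data =
  fobj :: "'o1 \<Rightarrow> 'o2"
  fmap :: "'o1 \<Rightarrow> 'o1 \<Rightarrow> 'm1 \<Rightarrow> 'm2"

definition is_functor ::
  "('o1, 'm1) category \<Rightarrow> ('o2, 'm2) category \<Rightarrow> ('o1, 'm1, 'o2, 'm2) functor_data \<Rightarrow> bool" where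
  "is_functor C D T \<longleftrightarrow> is_category C \<and> is_category D \<and>
     (\<forall>a\<in>obj C. fobj T a \<in> obj D) \<and>
     (\<forall>a\<in>obj C. \<forall>b\<in>obj C. \<forall>u\<in>hom_set C a b. fmap T a b u \<in> hom_set D (fobj T a) (fobj T b)) \<and>
     (\<forall>a\<in>obj C. fmap T a a (ident C a) = ident D (fobj T a)) \<and>
     (\<forall>a\<in>obj C. \<forall>b\<in>obj C. \<forall>c\<in>obj C. \<forall>u\<in>hom_set C a b. \<forall>v\<in>hom_set C b c.
        fmap T a c (comp C a b c v u) =
        comp D (fobj T a) (fobj T b) (fobj T c) (fmap T b c v) (fmap T a b u))"

definition id_functor :: "('o, 'm, 'o, 'm) functor_data" where
  "id_functor = \<lparr>fobj = (\<lambda>a. a), fmap = (\<lambda>a b u. u)\<rparr>"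

definition comp_functor ::
  "('o2, 'm2, 'o3, 'm3) functor_data \<Rightarrow> ('o1, 'm1, 'o2, 'm2) functor_data \<Rightarrow>
   ('o1, 'm1, 'o3, 'm3) functor_data" (infixr \<open>\<circ>\<^sub>F\<close> 55) where
  "T \<circ>\<^sub>F S = \<lparr>fobj = (\<lambda>a. fobj T (fobj S a)),
              fmap = (\<lambda>a b u. fmap T (fobj S a) (fobj S b) (fmap S a b u))\<rparr>"

definition natural_transformation ::
  "('o1, 'm1) category \<Rightarrow> ('o2, 'm2) category \<Rightarrow> ('o1, 'm1, 'o2, 'm2) functor_data \<Rightarrow>
   ('o1, 'm1, 'o2, 'm2) functor_data \<Rightarrow> ('o1 \<Rightarrow> 'm2) \<Rightarrow> bool" where
  "natural_transformation C D S T \<tau> \<longleftrightarrow> is_functor C D S \<and> is_functor C D T \<and>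
     (\<forall>a\<in>obj C. \<tau> a \<in> hom_set D (fobj S a) (fobj T a)) \<and>
     (\<forall>a\<in>obj C. \<forall>b\<in>obj C. \<forall>u\<in>hom_set C a b.
        comp D (fobj S a) (fobj T a) (fobj T b) (fmap T a b u) (\<tau> a) =
        comp D (fobj S a) (fobj S b) (fobj T b) (\<tau> b) (fmap S a b u))"

text \<open>\<open>L : C \<rightarrow> D\<close> is left adjoint to \<open>M : D \<rightarrow> C\<close> with unit \<open>\<eta>\<close> and counit \<open>\<epsilon>\<close>.\<close>

definition adjunction ::
  "('o1, 'm1) category \<Rightarrow> ('o2, 'm2) category \<Rightarrow> ('o1, 'm1, 'o2, 'm2) functor_data \<Rightarrow>
   ('o2, 'm2, 'o1, 'm1) functor_data \<Rightarrow> ('o1 \<Rightarrow> 'm1) \<Rightarrow> ('o2 \<Rightarrow> 'm2) \<Rightarrow> bool" where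
  "adjunction C D L M \<eta> \<epsilon> \<longleftrightarrow> is_functor C D L \<and> is_functor D C M \<and>
     natural_transformation C C id_functor (M \<circ>\<^sub>F L) \<eta> \<and>
     natural_transformation D D (L \<circ>\<^sub>F M) id_functor \<epsilon> \<and>
     (\<forall>a\<in>obj C.
        comp D (fobj L a) (fobj L (fobj M (fobj L a))) (fobj L a)
          (\<epsilon> (fobj L a)) (fmap L a (fobj M (fobj L a)) (\<eta> a)) = ident D (fobj L a)) \<and>
     (\<forall>b\<in>obj D.
        comp C (fobj M b) (fobj M (fobj L (fobj M b))) (fobj M b)
          (fmap M (fobj L (fobj M b)) b (\<epsilon> b)) (\<eta> (fobj M b)) = ident C (fobj M b))"


section \<open>Graded rings\<close>

text \<open>The group of degrees is a multiplicatively written HOL-Algebra group, so the condition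
  on products reads \<open>R\<^sub>g R\<^sub>h \<subseteq> R\<^sub>g\<^sub>h\<close>.\<close>

record ('a, 'g) graded_ring = "'a ring" +
  piece :: "'g \<Rightarrow> 'a set"

definition finsupp_families ::
  "('a, 'b) ring_scheme \<Rightarrow> 'i set \<Rightarrow> ('i \<Rightarrow> 'a set) \<Rightarrow> ('i \<Rightarrow> 'a) set" where
  "finsupp_families R I M = {c \<in> (\<Pi>\<^sub>E i\<in>I. M i). finite {i \<in> I. c i \<noteq> \<zero>\<^bsub>R\<^esub>}}"

definition family_sum :: "('a, 'b) ring_scheme \<Rightarrow> 'i set \<Rightarrow> ('i \<Rightarrow> 'a) \<Rightarrow> 'a" where
  "family_sum R I c = (\<Oplus>\<^bsub>R\<^esub>i\<in>{i \<in> I. c i \<noteq> \<zero>\<^bsub>R\<^esub>}. c i)"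

definition is_graded_ring :: "('g, 'c) monoid_scheme \<Rightarrow> ('a, 'g) graded_ring \<Rightarrow> bool" where
  "is_graded_ring G R \<longleftrightarrow> cring R \<and>
     (\<forall>g\<in>carrier G. additive_subgroup (piece R g) R) \<and>
     bij_betw (family_sum R (carrier G))
       (finsupp_families R (carrier G) (piece R)) (carrier R) \<and>
     (\<forall>g\<in>carrier G. \<forall>h\<in>carrier G. \<forall>x\<in>piece R g. \<forall>y\<in>piece R h.
        x \<otimes>\<^bsub>R\<^esub> y \<in> piece R (g \<otimes>\<^bsub>G\<^esub> h))"

definition graded_hom ::
  "('g, 'c) monoid_scheme \<Rightarrow> ('a, 'g) graded_ring \<Rightarrow> ('b, 'g) graded_ring \<Rightarrow> ('a \<Rightarrow> 'b) set" where
  "graded_hom G R S =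
     {u \<in> ring_hom R S. u \<in> extensional (carrier R) \<and> (\<forall>g\<in>carrier G. u ` piece R g \<subseteq> piece S g)}"

text \<open>The category of \<open>G\<close>-graded rings whose elements are taken from the type \<open>'a\<close>.\<close>

definition Ann :: "('g, 'c) monoid_scheme \<Rightarrow> (('a, 'g) graded_ring, 'a \<Rightarrow> 'a) category" where
  "Ann G = \<lparr>obj = {R. is_graded_ring G R},
            hom_set = graded_hom G,
            ident = (\<lambda>R. \<lambda>x\<in>carrier R. x),
            comp = (\<lambda>R S T v u. compose (carrier R) v u)\<rparr>"

text \<open>Equality of graded rings. Equality of records would also compare the values
  of the operations outside the carrier and of the graduation outside the group of degrees.\<close>

definition same_graded_ring ::
  "('g, 'c) monoid_scheme \<Rightarrow> ('a, 'g) graded_ring \<Rightarrow> ('a, 'g) graded_ring \<Rightarrow> bool" where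
  "same_graded_ring G R S \<longleftrightarrow> carrier R = carrier S \<and>
     (\<forall>x\<in>carrier R. \<forall>y\<in>carrier R. x \<otimes>\<^bsub>R\<^esub> y = x \<otimes>\<^bsub>S\<^esub> y \<and> x \<oplus>\<^bsub>R\<^esub> y = x \<oplus>\<^bsub>S\<^esub> y) \<and>
     \<one>\<^bsub>R\<^esub> = \<one>\<^bsub>S\<^esub> \<and> \<zero>\<^bsub>R\<^esub> = \<zero>\<^bsub>S\<^esub> \<and> (\<forall>g\<in>carrier G. piece R g = piece S g)"


section \<open>Restriction\<close>

definition restriction ::
  "('f, 'c) monoid_scheme \<Rightarrow> ('f \<Rightarrow> 'g) \<Rightarrow> ('a, 'g) graded_ring \<Rightarrow> ('a, 'f) graded_ring" where
  "restriction F \<phi> R =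
     \<lparr>carrier = family_sum R (carrier F) ` finsupp_families R (carrier F) (\<lambda>f. piece R (\<phi> f)),
      monoid.mult = monoid.mult R, one = one R, zero = zero R, add = add R,
      piece = (\<lambda>f. piece R (\<phi> f))\<rparr>"

definition restriction_functor ::
  "('f, 'c) monoid_scheme \<Rightarrow> ('f \<Rightarrow> 'g) \<Rightarrow>
   (('a, 'g) graded_ring, 'a \<Rightarrow> 'a, ('a, 'f) graded_ring, 'a \<Rightarrow> 'a) functor_data" where
  "restriction_functor F \<phi> =
     \<lparr>fobj = restriction F \<phi>,
      fmap = (\<lambda>R S u. restrict u (carrier (restriction F \<phi> R)))\<rparr>"


section \<open>Extension\<close>

definition extension ::
  "('f, 'c) monoid_scheme \<Rightarrow> ('f \<Rightarrow> 'g) \<Rightarrow> ('a, 'f) graded_ring \<Rightarrow> ('a, 'g) graded_ring" where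
  "extension F \<phi> S =
     \<lparr>carrier = carrier S, monoid.mult = monoid.mult S, one = one S, zero = zero S, add = add S,
      piece = (\<lambda>g. if g \<in> \<phi> ` carrier F then piece S (inv_into (carrier F) \<phi> g) else {\<zero>\<^bsub>S\<^esub>})\<rparr>"

definition extension_functor ::
  "('f, 'c) monoid_scheme \<Rightarrow> ('f \<Rightarrow> 'g) \<Rightarrow>
   (('a, 'f) graded_ring, 'a \<Rightarrow> 'a, ('a, 'g) graded_ring, 'a \<Rightarrow> 'a) functor_data" where
  "extension_functor F \<phi> = \<lparr>fobj = extension F \<phi>, fmap = (\<lambda>R S u. u)\<rparr>"


section \<open>Quotients and corestriction\<close>

text \<open>The elements of \<open>R Quot I\<close> are subsets of \<open>'a\<close>. To have quotients available
  in the category of graded rings over \<open>'a\<close>, the ring structure of \<open>R Quot I\<close> is transported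
  along the injection that sends every coset to a chosen representative. A singleton coset
  is sent to its element, so for \<open>I = {\<zero>}\<close> this realises the canonical identification of
  \<open>R Quot I\<close> with \<open>R\<close>.\<close>

definition coset_rep :: "'a set \<Rightarrow> 'a" where
  "coset_rep X = (SOME x. x \<in> X)"

definition quotient_ring :: "('a, 'b) ring_scheme \<Rightarrow> 'a set \<Rightarrow> 'a ring" where
  "quotient_ring R I = image_ring coset_rep (R Quot I)"

lemma quotient_ring_iso:
  assumes "ideal I R"
  shows "coset_rep \<in> ring_iso (R Quot I) (quotient_ring R I)"
proof -
  interpret ideal I R by fact
  have rep: "coset_rep X \<in> X" if "X \<in> a_rcosets\<^bsub>R\<^esub> I" for X
  proof -
    from that obtain x where "x \<in> carrier R" "X = I +>\<^bsub>R\<^esub> x"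
      by (auto simp: A_RCOSETS_def')
    then have "x \<in> X" using a_rcos_self by blast
    then show ?thesis unfolding coset_rep_def by (rule someI)
  qed
  have "inj_on coset_rep (a_rcosets\<^bsub>R\<^esub> I)"
  proof (rule inj_onI)
    fix X Y assume XY: "X \<in> a_rcosets\<^bsub>R\<^esub> I" "Y \<in> a_rcosets\<^bsub>R\<^esub> I" "coset_rep X = coset_rep Y"
    then have "coset_rep X \<in> X \<inter> Y" using rep by (metis IntI)
    then show "X = Y" using a_rcos_disjoint XY(1,2)
      by (auto simp: pairwise_def disjnt_def)
  qed
  then have "inj_on coset_rep (carrier (R Quot I))" by (simp add: FactRing_def)
  then show ?thesis unfolding quotient_ring_def
    by (rule inj_imp_image_ring_iso)
qed

text \<open>The canonical projection from \<open>R\<close> to \<open>quotient_ring R I\<close>.\<close>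

definition projection :: "('a, 'b) ring_scheme \<Rightarrow> 'a set \<Rightarrow> 'a \<Rightarrow> 'a" where
  "projection R I = (\<lambda>x\<in>carrier R. coset_rep (I +>\<^bsub>R\<^esub> x))"

definition graded_quotient :: "('a, 'g) graded_ring \<Rightarrow> 'a set \<Rightarrow> ('a, 'g) graded_ring" where
  "graded_quotient R I =
     \<lparr>carrier = carrier (quotient_ring R I), monoid.mult = monoid.mult (quotient_ring R I),
      one = one (quotient_ring R I), zero = zero (quotient_ring R I),
      add = add (quotient_ring R I),
      piece = (\<lambda>g. projection R I ` piece R g)\<rparr>"

definition corestriction_ideal ::
  "('f, 'c) monoid_scheme \<Rightarrow> ('g, 'd) monoid_scheme \<Rightarrow> ('f \<Rightarrow> 'g) \<Rightarrow> ('a, 'g) graded_ring \<Rightarrow> 'a set"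
  where "corestriction_ideal F G \<phi> R = Idl\<^bsub>R\<^esub> (\<Union>g\<in>carrier G - \<phi> ` carrier F. piece R g)"

definition corestriction ::
  "('f, 'c) monoid_scheme \<Rightarrow> ('g, 'd) monoid_scheme \<Rightarrow> ('f \<Rightarrow> 'g) \<Rightarrow>
   ('a, 'g) graded_ring \<Rightarrow> ('a, 'f) graded_ring" where
  "corestriction F G \<phi> R = restriction F \<phi> (graded_quotient R (corestriction_ideal F G \<phi> R))"

text \<open>A morphism \<open>u : R \<rightarrow> S\<close> induces the map sending the class of \<open>x\<close> to the class of \<open>u x\<close>.
  The preimage of a class is chosen by \<open>inv_into\<close>; the value does not depend on it.\<close>

definition corestriction_functor ::
  "('f, 'c) monoid_scheme \<Rightarrow> ('g, 'd) monoid_scheme \<Rightarrow> ('f \<Rightarrow> 'g) \<Rightarrow>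
   (('a, 'g) graded_ring, 'a \<Rightarrow> 'a, ('a, 'f) graded_ring, 'a \<Rightarrow> 'a) functor_data" where
  "corestriction_functor F G \<phi> =
     \<lparr>fobj = corestriction F G \<phi>,
      fmap = (\<lambda>R S u. \<lambda>y\<in>carrier (corestriction F G \<phi> R).
        projection S (corestriction_ideal F G \<phi> S)
          (u (inv_into (carrier R) (projection R (corestriction_ideal F G \<phi> R)) y)))\<rparr>"


section \<open>Units and counits\<close>

definition alpha ::
  "('f, 'c) monoid_scheme \<Rightarrow> ('g, 'd) monoid_scheme \<Rightarrow> ('f \<Rightarrow> 'g) \<Rightarrow> ('a, 'g) graded_ring \<Rightarrow> 'a \<Rightarrow> 'a"
  where "alpha F G \<phi> R = projection R (corestriction_ideal F G \<phi> R)"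

definition inclusion ::
  "('f, 'c) monoid_scheme \<Rightarrow> ('f \<Rightarrow> 'g) \<Rightarrow> ('a, 'g) graded_ring \<Rightarrow> 'a \<Rightarrow> 'a" where
  "inclusion F \<phi> R = (\<lambda>x\<in>carrier (extension F \<phi> (restriction F \<phi> R)). x)"

definition identity_map :: "('a, 'g) graded_ring \<Rightarrow> 'a \<Rightarrow> 'a" where
  "identity_map S = (\<lambda>x\<in>carrier S. x)"

end

theory Submission
  imports Defs "HOL-Algebra.Subrings"
begin

text \<open>Write \<open>I(R)\<close> for the ideal of a \<open>G\<close>-graded ring \<open>R\<close> generated by the pieces whose degrees lie
  outside the image of \<open>\<phi>\<close>.

  A morphism from \<open>R\<close> to an extension kills these pieces, so it factors uniquely
  through \<open>R / I(R)\<close>; a morphism from an extension to \<open>R\<close> has its image in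
  the sum of the pieces with degrees in the image of \<open>\<phi>\<close>. These are the two adjunctions. They are
  verified here through naturality and the triangle identities, on elements.

  The work lies in showing that the three constructions yield graded rings. All of it is done with
  the homogeneous components of an element: the grading axiom is equivalent to
  spanning and independence of the pieces (\<open>is_graded_ringI\<close>, \<open>component_finsum\<close>),
  and a homogeneous factor shifts components by its degree (\<open>component_mult\<close>). Two facts that are not
  among the axioms follow from the shift. The unit has degree \<open>\<one>\<close> (\<open>one_piece\<close>), hence it
  belongs to the restriction. An ideal generated by pieces contains the components of its
  elements (\<open>homogeneous_genideal\<close>), hence \<open>R / I(R)\<close> is graded by the images of the pieces.

  The quotient lives on representatives of cosets. The arguments about functors and adjunctions use
  only that \<open>alpha\<close> is a surjective ring homomorphism with kernel \<open>I(R)\<close>, together with the fact that it is the identity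
  on extensions (\<open>alpha_extension\<close>), where the ideal is zero. The effect of the
  corestriction functor on morphisms is determined by \<open>corestriction_map\<close>.\<close>

section \<open>Additive subgroups and sums along ring homomorphisms\<close>

lemma (in ring) additive_subgroup_closedI:
  assumes "H \<subseteq> carrier R" and "\<zero> \<in> H"
    and "\<And>x y. x \<in> H \<Longrightarrow> y \<in> H \<Longrightarrow> x \<oplus> y \<in> H" and "\<And>x. x \<in> H \<Longrightarrow> \<ominus> x \<in> H"
  shows "additive_subgroup H R"
proof (rule additive_subgroup.intro, rule add.subgroupI)
  show "H \<noteq> {}" using assms(2) by auto
qed (use assms in \<open>auto simp: a_inv_def\<close>)

lemma (in ring) additive_subgroup_finsum:
  assumes "additive_subgroup H R" and "\<And>i. i \<in> A \<Longrightarrow> c i \<in> H"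
  shows "finsum R c A \<in> H"
proof -
  interpret H: additive_subgroup H R by fact
  show ?thesis
    using assms(2)
  proof (induction A rule: infinite_finite_induct)
    case (insert i A)
    then have "finsum R c (insert i A) = c i \<oplus> finsum R c A"
      by (intro finsum_insert) (auto simp: H.a_Hcarr)
    with insert show ?case by (auto intro: H.a_closed)
  qed auto
qed

text \<open>Finite sums in \<open>S\<close> and in \<open>R\<close> are different terms even when the operations agree, because
  \<open>finsum\<close> depends on the carrier. Regarding the identity as a homomorphism from \<open>S\<close> to \<open>R\<close>
  is what moves sums and additive inverses between the two rings.\<close>
lemma (in cring) inclusion_ring_hom_cring:
  assumes "subring (carrier S) R"
    and mult: "monoid.mult S = monoid.mult R" and one: "one S = one R"
    and zero: "zero S = zero R" and add: "add S = add R"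
  shows "ring_hom_cring S R (\<lambda>x. x)"
proof -
  note sub = subringE[OF assms(1)]
  note ops = mult one zero add
  note carr = subsetD[OF sub(1)]
  have "cring S"
  proof (intro cringI abelian_groupI comm_monoidI)
    show "\<exists>y\<in>carrier S. y \<oplus>\<^bsub>S\<^esub> x = \<zero>\<^bsub>S\<^esub>" if "x \<in> carrier S" for x
      using that sub(1,5) by (intro bexI[of _ "\<ominus> x"]) (auto simp: ops l_neg)
  qed (simp_all add: ops sub(2,3,6,7) carr a_assoc m_assoc l_distr, simp_all add: carr a_comm m_comm)
  moreover have "(\<lambda>x. x) \<in> ring_hom S R"
    using sub(1) by (auto simp: ring_hom_def ops)
  ultimately show ?thesis
    by (simp add: ring_hom_cring_def ring_hom_cring_axioms_def is_cring)
qed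

lemma (in ring_hom_cring) hom_eq_iff:
  assumes "x \<in> carrier R" "y \<in> carrier R"
  shows "h x = h y \<longleftrightarrow> h (x \<ominus>\<^bsub>R\<^esub> y) = \<zero>\<^bsub>S\<^esub>"
proof -
  have "h (x \<ominus>\<^bsub>R\<^esub> y) = h x \<ominus>\<^bsub>S\<^esub> h y"
    using assms by (simp add: R.minus_eq S.minus_eq)
  then show ?thesis using S.r_right_minus_eq[of "h x" "h y"] assms by simp
qed

locale subring_inclusion = ring_hom_cring S R "\<lambda>x. x" for S and R
begin

lemma carrier_subset: "x \<in> carrier S \<Longrightarrow> x \<in> carrier R"
  by (rule hom_closed)

lemma finsum_inclusion:
  assumes "\<And>i. i \<in> A \<Longrightarrow> c i \<in> carrier S"
  shows "finsum S c A = finsum R c A"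
  using hom_finsum[of c A] assms by (simp add: Pi_def comp_def)

lemma additive_subgroup_inclusion:
  assumes "additive_subgroup H R" "H \<subseteq> carrier S"
  shows "additive_subgroup H S"
proof -
  interpret H: additive_subgroup H R by fact
  show ?thesis
  proof (rule R.additive_subgroup_closedI)
    show "\<zero>\<^bsub>S\<^esub> \<in> H" using hom_zero H.zero_closed by metis
    show "x \<oplus>\<^bsub>S\<^esub> y \<in> H" if "x \<in> H" "y \<in> H" for x y
    proof -
      have "x \<oplus>\<^bsub>S\<^esub> y = x \<oplus>\<^bsub>R\<^esub> y" using that assms(2) by (intro hom_add) auto
      then show ?thesis using H.a_closed[OF that] by metis
    qed
    show "\<ominus>\<^bsub>S\<^esub> x \<in> H" if "x \<in> H" for x
    proof -
      have "\<ominus>\<^bsub>S\<^esub> x = \<ominus>\<^bsub>R\<^esub> x" using that assms(2) by (intro hom_a_inv) auto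
      then show ?thesis using H.a_inv_closed[OF that] by metis
    qed
  qed fact
qed

end

lemma (in ring_hom_cring) image_additive_subgroup:
  assumes "additive_subgroup H R"
  shows "additive_subgroup (h ` H) S"
proof -
  interpret H: additive_subgroup H R by fact
  show ?thesis
  proof (rule S.additive_subgroup_closedI)
    show "h ` H \<subseteq> carrier S" by (auto simp: H.a_Hcarr)
    show "\<zero>\<^bsub>S\<^esub> \<in> h ` H" using hom_zero H.zero_closed by (metis imageI)
    show "x \<oplus>\<^bsub>S\<^esub> y \<in> h ` H" if "x \<in> h ` H" "y \<in> h ` H" for x y
    proof -
      from that obtain a b where "a \<in> H" "b \<in> H" "x = h a" "y = h b" by blast
      then have "x \<oplus>\<^bsub>S\<^esub> y = h (a \<oplus> b)" "a \<oplus> b \<in> H" by (simp_all add: H.a_Hcarr H.a_closed)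
      then show ?thesis by blast
    qed
    show "\<ominus>\<^bsub>S\<^esub> x \<in> h ` H" if "x \<in> h ` H" for x
    proof -
      from that obtain a where "a \<in> H" "x = h a" by blast
      then have "\<ominus>\<^bsub>S\<^esub> x = h (\<ominus> a)" "\<ominus> a \<in> H" by (simp_all add: H.a_Hcarr H.a_inv_closed)
      then show ?thesis by blast
    qed
  qed
qed

section \<open>Homogeneous components\<close>

text \<open>Canonical families are indexed by all of \<open>I\<close> and summed over their support; replacing them by
  arbitrary families on arbitrary finite subsets of \<open>I\<close> makes sums easy to produce and to combine.\<close>
lemma (in ring) family_sum_image:
  assumes "\<And>i. i \<in> I \<Longrightarrow> additive_subgroup (M i) R"
  shows "family_sum R I ` finsupp_families R I M =
    {finsum R c A | A c. finite A \<and> A \<subseteq> I \<and> (\<forall>i\<in>A. c i \<in> M i)}" (is "?L = ?R")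
proof
  have zero: "\<zero> \<in> M i" and sub: "M i \<subseteq> carrier R" if "i \<in> I" for i
    using additive_subgroup.zero_closed additive_subgroup.a_subset assms[OF that] by blast+
  show "?L \<subseteq> ?R"
    unfolding finsupp_families_def family_sum_def by (blast dest: PiE_mem)
  show "?R \<subseteq> ?L"
  proof
    fix x assume "x \<in> ?R"
    then obtain A c where A: "finite A" "A \<subseteq> I" "\<forall>i\<in>A. c i \<in> M i" and x: "x = finsum R c A"
      by auto
    define d where "d = (\<lambda>i\<in>I. if i \<in> A then c i else \<zero>)"
    have "{i \<in> I. d i \<noteq> \<zero>} \<subseteq> A" by (auto simp: d_def split: if_splits)
    then have "d \<in> finsupp_families R I M"
      using A zero by (auto simp: finsupp_families_def d_def dest: finite_subset)
    moreover have "family_sum R I d = x"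
      unfolding family_sum_def x
      using A sub by (intro add.finprod_mono_neutral_cong_left) (auto simp: d_def subset_iff)
    ultimately show "x \<in> ?L" by blast
  qed
qed

text \<open>Bijectivity of the summation map amounts to spanning and independence. For injectivity, two
  families with the same sum are subtracted on the union of their supports.\<close>
lemma is_graded_ringI:
  fixes R :: "('a, 'g) graded_ring" (structure) and G :: "('g, 'c) monoid_scheme"
  assumes "cring R" and "\<And>g. g \<in> carrier G \<Longrightarrow> additive_subgroup (piece R g) R"
    and span: "\<And>x. x \<in> carrier R \<Longrightarrow>
      \<exists>A c. finite A \<and> A \<subseteq> carrier G \<and> (\<forall>g\<in>A. c g \<in> piece R g) \<and> x = finsum R c A"
    and indep: "\<And>A c g. finite A \<Longrightarrow> A \<subseteq> carrier G \<Longrightarrow> \<forall>g\<in>A. c g \<in> piece R g \<Longrightarrow>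
      finsum R c A = \<zero>\<^bsub>R\<^esub> \<Longrightarrow> g \<in> A \<Longrightarrow> c g = \<zero>\<^bsub>R\<^esub>"
    and "\<And>g h x y. g \<in> carrier G \<Longrightarrow> h \<in> carrier G \<Longrightarrow> x \<in> piece R g \<Longrightarrow> y \<in> piece R h \<Longrightarrow>
      x \<otimes>\<^bsub>R\<^esub> y \<in> piece R (g \<otimes>\<^bsub>G\<^esub> h)"
  shows "is_graded_ring G R"
proof -
  interpret cring R by fact
  have sub: "c g \<in> carrier R" if "c g \<in> piece R g" "g \<in> carrier G" for c g
    using additive_subgroup.a_Hcarr[OF assms(2)] that by blast
  have "inj_on (family_sum R (carrier G)) (finsupp_families R (carrier G) (piece R))"
  proof (rule inj_onI)
    fix c d assume c: "c \<in> finsupp_families R (carrier G) (piece R)"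
      and d: "d \<in> finsupp_families R (carrier G) (piece R)"
      and eq: "family_sum R (carrier G) c = family_sum R (carrier G) d"
    define A where "A = {g \<in> carrier G. c g \<noteq> \<zero>\<^bsub>R\<^esub>} \<union> {g \<in> carrier G. d g \<noteq> \<zero>\<^bsub>R\<^esub>}"
    have pieces: "c g \<in> piece R g" "d g \<in> piece R g" if "g \<in> carrier G" for g
      using c d that by (auto simp: finsupp_families_def)
    then have carr: "c g \<in> carrier R" "d g \<in> carrier R" if "g \<in> carrier G" for g
      using that sub by auto
    have A: "finite A" "A \<subseteq> carrier G"
      using c d by (auto simp: A_def finsupp_families_def)
    have c_sum: "family_sum R (carrier G) c = finsum R c A"
      unfolding family_sum_def
      by (rule add.finprod_mono_neutral_cong_left) (use A carr in \<open>auto simp: A_def\<close>)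
    have d_sum: "family_sum R (carrier G) d = finsum R d A"
      unfolding family_sum_def
      by (rule add.finprod_mono_neutral_cong_left) (use A carr in \<open>auto simp: A_def\<close>)
    \<comment> \<open>The difference of the two families, written with a factor \<open>\<ominus> \<one>\<close> so that
      distributivity over finite sums takes the sign out.\<close>
    define e where "e = (\<lambda>g. c g \<oplus> \<ominus> \<one> \<otimes> d g)"
    have e_minus: "e g = c g \<ominus> d g" if "g \<in> A" for g
      using carr A that by (auto simp: e_def l_minus minus_eq)
    have "finsum R e A = finsum R c A \<oplus> finsum R (\<lambda>g. \<ominus> \<one> \<otimes> d g) A"
      unfolding e_def using carr A by (intro finsum_addf) auto
    also have "finsum R (\<lambda>g. \<ominus> \<one> \<otimes> d g) A = \<ominus> \<one> \<otimes> finsum R d A"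
      using carr A by (intro finsum_rdistr[symmetric]) auto
    also have "\<dots> = \<ominus> finsum R c A"
    proof -
      have "finsum R d A \<in> carrier R" using carr A by (intro finsum_closed) auto
      then show ?thesis using eq by (simp add: c_sum d_sum l_minus)
    qed
    also have "finsum R c A \<oplus> \<ominus> finsum R c A = \<zero>"
      using carr A by (intro r_neg finsum_closed) auto
    finally have "finsum R e A = \<zero>" .
    moreover have "\<forall>g\<in>A. e g \<in> piece R g"
    proof
      fix g assume g: "g \<in> A"
      then have gG: "g \<in> carrier G" using A by auto
      interpret p: additive_subgroup "piece R g" R by (rule assms(2)[OF gG])
      show "e g \<in> piece R g"
        unfolding e_minus[OF g] minus_eq using pieces[OF gG]
        by (auto intro: p.a_closed p.a_inv_closed)
    qed
    ultimately have "e g = \<zero>" if "g \<in> A" for g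
      using indep[OF A, of e g] that by blast
    then have "c g \<ominus> d g = \<zero>" if "g \<in> A" for g
      using that e_minus[OF that] by simp
    then have "c g = d g" if "g \<in> A" for g
      using r_right_minus_eq[OF carr(1) carr(2), of g g] that A by blast
    moreover have "c g = d g" if "g \<in> carrier G - A" for g
      using that by (auto simp: A_def)
    moreover have "c g = d g" if "g \<notin> carrier G" for g
      using c d that by (auto simp: finsupp_families_def PiE_def extensional_def)
    ultimately show "c = d" by (intro ext) blast
  qed
  moreover have "family_sum R (carrier G) ` finsupp_families R (carrier G) (piece R) = carrier R"
  proof (subst family_sum_image[OF assms(2)]; (intro equalityI subsetI)?)
    fix x assume "x \<in> {finsum R c A | A c.
      finite A \<and> A \<subseteq> carrier G \<and> (\<forall>g\<in>A. c g \<in> piece R g)}"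
    then obtain A c where A: "A \<subseteq> carrier G" "\<forall>g\<in>A. c g \<in> piece R g" and x: "x = finsum R c A"
      by blast
    then have "c \<in> A \<rightarrow> carrier R" using sub by blast
    then show "x \<in> carrier R" unfolding x by (rule finsum_closed)
  next
    fix x assume "x \<in> carrier R"
    then show "x \<in> {finsum R c A | A c.
        finite A \<and> A \<subseteq> carrier G \<and> (\<forall>g\<in>A. c g \<in> piece R g)}"
      using span by blast
  qed
  ultimately have "bij_betw (family_sum R (carrier G))
      (finsupp_families R (carrier G) (piece R)) (carrier R)"
    by (simp add: bij_betw_def)
  with assms(1,2,5) show ?thesis
    by (simp add: is_graded_ring_def)
qed

definition component ::
  "('g, 'c) monoid_scheme \<Rightarrow> ('a, 'g) graded_ring \<Rightarrow> 'g \<Rightarrow> 'a \<Rightarrow> 'a" where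
  "component G R g x =
     inv_into (finsupp_families R (carrier G) (piece R)) (family_sum R (carrier G)) x g"

locale graded_cring = R: cring R + G: group G
  for R :: "('a, 'g) graded_ring" (structure) and G :: "('g, 'c) monoid_scheme" +
  assumes graded: "is_graded_ring G R"

lemma graded_cringI: "group G \<Longrightarrow> is_graded_ring G R \<Longrightarrow> graded_cring R G"
  by (simp add: graded_cring_def graded_cring_axioms_def is_graded_ring_def)

context graded_cring
begin

lemma piece_subgroup: "g \<in> carrier G \<Longrightarrow> additive_subgroup (piece R g) R"
  using graded by (simp add: is_graded_ring_def)

lemma piece_mult:
  "g \<in> carrier G \<Longrightarrow> h \<in> carrier G \<Longrightarrow> x \<in> piece R g \<Longrightarrow> y \<in> piece R h \<Longrightarrow>
    x \<otimes> y \<in> piece R (g \<otimes>\<^bsub>G\<^esub> h)"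
  using graded by (simp add: is_graded_ring_def)

lemma piece_carrier: "g \<in> carrier G \<Longrightarrow> x \<in> piece R g \<Longrightarrow> x \<in> carrier R"
  using additive_subgroup.a_Hcarr[OF piece_subgroup] by blast

lemma piece_zero: "g \<in> carrier G \<Longrightarrow> \<zero> \<in> piece R g"
  using additive_subgroup.zero_closed[OF piece_subgroup] by blast

lemma bij_family_sum: "bij_betw (family_sum R (carrier G))
    (finsupp_families R (carrier G) (piece R)) (carrier R)"
  using graded by (simp add: is_graded_ring_def)

lemma component_family:
  assumes "x \<in> carrier R"
  shows "(\<lambda>g. component G R g x) \<in> finsupp_families R (carrier G) (piece R)"
  unfolding component_def using bij_family_sum assms by (simp add: bij_betw_def inv_into_into)

lemma component_piece: "x \<in> carrier R \<Longrightarrow> g \<in> carrier G \<Longrightarrow> component G R g x \<in> piece R g"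
  using component_family by (auto simp: finsupp_families_def)

lemma component_carrier: "x \<in> carrier R \<Longrightarrow> g \<in> carrier G \<Longrightarrow> component G R g x \<in> carrier R"
  using component_piece piece_carrier by blast

lemma finite_components: "x \<in> carrier R \<Longrightarrow> finite {g \<in> carrier G. component G R g x \<noteq> \<zero>}"
  using component_family by (auto simp: finsupp_families_def)

lemma sum_components:
  assumes "x \<in> carrier R" "finite A" "A \<subseteq> carrier G"
    and "\<And>g. g \<in> carrier G - A \<Longrightarrow> component G R g x = \<zero>"
  shows "finsum R (\<lambda>g. component G R g x) A = x"
proof -
  have "x = family_sum R (carrier G) (\<lambda>g. component G R g x)"
    unfolding component_def using bij_betw_inv_into_right[OF bij_family_sum assms(1)] by simp
  also have "\<dots> = finsum R (\<lambda>g. component G R g x) A"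
    unfolding family_sum_def
    by (rule R.add.finprod_mono_neutral_cong_left) (use assms component_carrier in auto)
  finally show ?thesis by simp
qed

lemma obtain_components:
  assumes "x \<in> carrier R"
  obtains A where "finite A" "A \<subseteq> carrier G" "x = finsum R (\<lambda>g. component G R g x) A"
    "\<And>g. g \<in> carrier G \<Longrightarrow> component G R g x \<noteq> \<zero> \<longleftrightarrow> g \<in> A"
proof (rule that)
  show "x = finsum R (\<lambda>g. component G R g x) {g \<in> carrier G. component G R g x \<noteq> \<zero>}"
    by (rule sum_components[symmetric]) (use finite_components assms in auto)
qed (use finite_components[OF assms] in auto)

text \<open>Uniqueness of the decomposition: any homogeneous expansion of an element exhibits its
  components. Every later computation of components goes through this rule.\<close>
lemma component_finsum:
  assumes "finite A" "A \<subseteq> carrier G" "\<forall>g\<in>A. c g \<in> piece R g" "g \<in> carrier G"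
  shows "component G R g (finsum R c A) = (if g \<in> A then c g else \<zero>)"
proof -
  define d where "d = (\<lambda>g\<in>carrier G. if g \<in> A then c g else \<zero>)"
  have "{g \<in> carrier G. d g \<noteq> \<zero>} \<subseteq> A" by (auto simp: d_def split: if_splits)
  then have d: "d \<in> finsupp_families R (carrier G) (piece R)"
    using assms piece_zero by (auto simp: finsupp_families_def d_def dest: finite_subset)
  have "family_sum R (carrier G) d = finsum R c A"
    unfolding family_sum_def
    using assms piece_carrier
    by (intro R.add.finprod_mono_neutral_cong_left) (auto simp: d_def subset_iff)
  then have "inv_into (finsupp_families R (carrier G) (piece R)) (family_sum R (carrier G))
      (finsum R c A) = d"
    using inv_into_f_f[OF bij_betw_imp_inj_on[OF bij_family_sum] d] by simp
  then show ?thesis using assms by (simp add: component_def d_def)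
qed

lemma component_homogeneous:
  assumes "h \<in> carrier G" "x \<in> piece R h" "g \<in> carrier G"
  shows "component G R g x = (if g = h then x else \<zero>)"
proof -
  have "finsum R (\<lambda>_. x) {h} = x"
    using piece_carrier[OF assms(1,2)] by simp
  then show ?thesis
    using component_finsum[of "{h}" "\<lambda>_. x" g] assms by simp
qed

lemma component_add:
  assumes "x \<in> carrier R" "y \<in> carrier R" "g \<in> carrier G"
  shows "component G R g (x \<oplus> y) = component G R g x \<oplus> component G R g y"
proof -
  define A where "A = {g \<in> carrier G. component G R g x \<noteq> \<zero>} \<union>
    {g \<in> carrier G. component G R g y \<noteq> \<zero>}"
  have A: "finite A" "A \<subseteq> carrier G"
    using finite_components assms by (auto simp: A_def)
  have "x = finsum R (\<lambda>g. component G R g x) A"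
    by (rule sum_components[symmetric]) (use A assms in \<open>auto simp: A_def\<close>)
  moreover have "y = finsum R (\<lambda>g. component G R g y) A"
    by (rule sum_components[symmetric]) (use A assms in \<open>auto simp: A_def\<close>)
  ultimately have "x \<oplus> y = finsum R (\<lambda>g. component G R g x \<oplus> component G R g y) A"
    using assms A component_carrier by (subst R.finsum_addf) (auto simp: subset_iff)
  moreover have "\<forall>g\<in>A. component G R g x \<oplus> component G R g y \<in> piece R g"
    using additive_subgroup.a_closed[OF piece_subgroup] component_piece assms A
    by (auto simp: subset_iff)
  ultimately have "component G R g (x \<oplus> y) =
      (if g \<in> A then component G R g x \<oplus> component G R g y else \<zero>)"
    using component_finsum[OF A _ assms(3)] by simp
  then show ?thesis using assms by (auto simp: A_def)
qed

lemma component_zero: "g \<in> carrier G \<Longrightarrow> component G R g \<zero> = \<zero>"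
  using component_homogeneous[OF _ piece_zero] by simp

lemma component_minus:
  assumes "x \<in> carrier R" "g \<in> carrier G"
  shows "component G R g (\<ominus> x) = \<ominus> component G R g x"
proof -
  have "component G R g (\<ominus> x) \<oplus> component G R g x = \<zero>"
    using component_add[of "\<ominus> x" x g] assms by (simp add: R.l_neg component_zero)
  from R.minus_equality[OF this] show ?thesis
    using assms component_carrier by simp
qed

text \<open>Multiplication by a homogeneous element of degree \<open>h\<close> shifts degrees by \<open>h\<close>. This is where
  inverses of degrees enter: translation by \<open>h\<close> must be injective for the shifted expansion to
  be a homogeneous expansion again.\<close>
lemma component_mult:
  assumes "h \<in> carrier G" "r \<in> piece R h" "x \<in> carrier R" "g \<in> carrier G"
  shows "component G R g (r \<otimes> x) = r \<otimes> component G R (inv\<^bsub>G\<^esub> h \<otimes>\<^bsub>G\<^esub> g) x"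
proof -
  from assms(3) obtain A where A: "finite A" "A \<subseteq> carrier G"
      "x = finsum R (\<lambda>g. component G R g x) A"
      "\<And>g. g \<in> carrier G \<Longrightarrow> component G R g x \<noteq> \<zero> \<longleftrightarrow> g \<in> A"
    by (rule obtain_components) blast
  have r: "r \<in> carrier R" using piece_carrier assms by blast
  define d where "d = (\<lambda>k. r \<otimes> component G R (inv\<^bsub>G\<^esub> h \<otimes>\<^bsub>G\<^esub> k) x)"
  have d: "d (h \<otimes>\<^bsub>G\<^esub> k) = r \<otimes> component G R k x" if "k \<in> carrier G" for k
    using that assms(1) by (simp add: d_def G.m_assoc[symmetric])
  let ?B = "(\<lambda>k. h \<otimes>\<^bsub>G\<^esub> k) ` A"
  have inj: "inj_on (\<lambda>k. h \<otimes>\<^bsub>G\<^esub> k) A"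
    using A assms by (auto simp: inj_on_def subset_iff)
  have "r \<otimes> x = r \<otimes> finsum R (\<lambda>g. component G R g x) A" using A(3) by simp
  also have "\<dots> = finsum R (\<lambda>k. r \<otimes> component G R k x) A"
    using A assms r component_carrier by (intro R.finsum_rdistr) (auto simp: subset_iff)
  also have "\<dots> = finsum R (\<lambda>k. d (h \<otimes>\<^bsub>G\<^esub> k)) A"
    using A assms r component_carrier by (intro R.finsum_cong') (auto simp: subset_iff d)
  also have "\<dots> = finsum R d ?B"
    using A assms r component_carrier by (intro R.finsum_reindex[symmetric] inj)
      (auto simp: subset_iff d)
  finally have "r \<otimes> x = finsum R d ?B" .
  moreover have "\<forall>k\<in>?B. d k \<in> piece R k"
    using A assms component_piece piece_mult by (auto simp: d subset_iff)
  moreover have "finite ?B" "?B \<subseteq> carrier G"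
    using A assms(1) by auto
  ultimately have "component G R g (r \<otimes> x) = (if g \<in> ?B then d g else \<zero>)"
    using component_finsum[of ?B d g] assms(4) by presburger
  moreover have "d g = \<zero>" if "g \<notin> ?B"
  proof -
    have "inv\<^bsub>G\<^esub> h \<otimes>\<^bsub>G\<^esub> g \<notin> A"
    proof
      assume "inv\<^bsub>G\<^esub> h \<otimes>\<^bsub>G\<^esub> g \<in> A"
      then have "h \<otimes>\<^bsub>G\<^esub> (inv\<^bsub>G\<^esub> h \<otimes>\<^bsub>G\<^esub> g) \<in> ?B" by blast
      then show False using that assms by (simp add: G.m_assoc[symmetric])
    qed
    then have "component G R (inv\<^bsub>G\<^esub> h \<otimes>\<^bsub>G\<^esub> g) x = \<zero>"
      using A(4) assms by (metis G.inv_closed G.m_closed)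
    then show ?thesis using r by (simp add: d_def)
  qed
  ultimately show ?thesis by (auto simp: d_def)
qed

text \<open>The axioms do not place the unit in degree \<open>\<one>\<close>. Let \<open>e\<close> be the component of the unit in that
  degree. By the shift rule, \<open>r \<otimes> e = r\<close> for homogeneous \<open>r\<close>, hence for all \<open>r\<close> by additivity,
  and so \<open>\<one> = \<one> \<otimes> e = e\<close>.\<close>
lemma one_piece: "\<one> \<in> piece R \<one>\<^bsub>G\<^esub>"
proof -
  define e where "e = component G R \<one>\<^bsub>G\<^esub> \<one>"
  have e: "e \<in> piece R \<one>\<^bsub>G\<^esub>" by (simp add: e_def component_piece)
  have eR: "e \<in> carrier R" using e piece_carrier by blast
  have homog: "r \<otimes> e = r" if "h \<in> carrier G" "r \<in> piece R h" for r h
    using component_mult[OF that R.one_closed that(1)] that piece_carrier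
    by (simp add: e_def component_homogeneous)
  obtain A where A: "finite A" "A \<subseteq> carrier G" "\<one> = finsum R (\<lambda>g. component G R g \<one>) A"
    using obtain_components[OF R.one_closed] by metis
  have "\<one> \<otimes> e = finsum R (\<lambda>g. component G R g \<one>) A \<otimes> e" using A(3) by simp
  also have "\<dots> = finsum R (\<lambda>g. component G R g \<one> \<otimes> e) A"
    using A component_carrier eR by (intro R.finsum_ldistr) (auto simp: subset_iff)
  also have "\<dots> = finsum R (\<lambda>g. component G R g \<one>) A"
    using A component_carrier component_piece homog
    by (intro R.finsum_cong') (auto simp: subset_iff)
  also have "\<dots> = \<one>" using A(3) by simp
  finally show ?thesis using e eR by simp
qed

end

section \<open>Extension and restriction\<close>

locale group_mono = F: group F + G: group G
  for F :: "('f, 'c) monoid_scheme" and G :: "('g, 'd) monoid_scheme" and \<phi> :: "'f \<Rightarrow> 'g" +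
  assumes mon: "\<phi> \<in> mon F G"
begin

lemma phi_closed: "f \<in> carrier F \<Longrightarrow> \<phi> f \<in> carrier G"
  using mon by (auto simp: mon_def hom_def)

lemma phi_mult: "f \<in> carrier F \<Longrightarrow> f' \<in> carrier F \<Longrightarrow> \<phi> (f \<otimes>\<^bsub>F\<^esub> f') = \<phi> f \<otimes>\<^bsub>G\<^esub> \<phi> f'"
  using mon by (auto simp: mon_def hom_def)

lemma phi_inj: "inj_on \<phi> (carrier F)"
  using mon by (auto simp: mon_def)

lemma phi_one: "\<phi> \<one>\<^bsub>F\<^esub> = \<one>\<^bsub>G\<^esub>"
proof -
  have "\<phi> \<in> hom F G" using mon by (simp add: mon_def)
  then show ?thesis using hom_one F.is_group G.is_group by blast
qed

text \<open>The complement of a subgroup is stable under translation by the subgroup. Hence products of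
  elements of a restriction have no components outside the image of \<open>\<phi>\<close>.\<close>
lemma image_translate:
  assumes "f \<in> carrier F" "g \<in> carrier G - \<phi> ` carrier F"
  shows "inv\<^bsub>G\<^esub> (\<phi> f) \<otimes>\<^bsub>G\<^esub> g \<in> carrier G - \<phi> ` carrier F"
proof -
  have "inv\<^bsub>G\<^esub> (\<phi> f) \<otimes>\<^bsub>G\<^esub> g \<notin> \<phi> ` carrier F"
  proof
    assume "inv\<^bsub>G\<^esub> (\<phi> f) \<otimes>\<^bsub>G\<^esub> g \<in> \<phi> ` carrier F"
    then obtain k where k: "k \<in> carrier F" "inv\<^bsub>G\<^esub> (\<phi> f) \<otimes>\<^bsub>G\<^esub> g = \<phi> k" by auto
    have "g = \<phi> f \<otimes>\<^bsub>G\<^esub> (inv\<^bsub>G\<^esub> (\<phi> f) \<otimes>\<^bsub>G\<^esub> g)"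
      using assms phi_closed by (simp add: G.m_assoc[symmetric])
    also have "\<dots> = \<phi> (f \<otimes>\<^bsub>F\<^esub> k)"
      using assms k by (simp add: phi_mult)
    finally have "g = \<phi> (f \<otimes>\<^bsub>F\<^esub> k)" .
    then show False using assms k by blast
  qed
  then show ?thesis using assms phi_closed by simp
qed

end

lemma extension_simps [simp]:
  "carrier (extension F \<phi> S) = carrier S"
  "monoid.mult (extension F \<phi> S) = monoid.mult S"
  "one (extension F \<phi> S) = one S"
  "zero (extension F \<phi> S) = zero S"
  "add (extension F \<phi> S) = add S"
  by (simp_all add: extension_def)

lemma restriction_simps [simp]:
  "monoid.mult (restriction F \<phi> R) = monoid.mult R"
  "one (restriction F \<phi> R) = one R"
  "zero (restriction F \<phi> R) = zero R"
  "add (restriction F \<phi> R) = add R"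
  "piece (restriction F \<phi> R) f = piece R (\<phi> f)"
  by (simp_all add: restriction_def)

context group_mono
begin

lemma piece_extension [simp]:
  "f \<in> carrier F \<Longrightarrow> piece (extension F \<phi> S) (\<phi> f) = piece S f"
  "g \<notin> \<phi> ` carrier F \<Longrightarrow> piece (extension F \<phi> S) g = {\<zero>\<^bsub>S\<^esub>}"
  by (simp_all add: extension_def inv_into_f_f[OF phi_inj])

lemma extension_graded:
  assumes "is_graded_ring F S"
  shows "is_graded_ring G (extension F \<phi> S)"
proof -
  interpret S: graded_cring S F
    by (rule graded_cringI[OF F.is_group assms])
  let ?E = "extension F \<phi> S"
  interpret E: subring_inclusion ?E S
    unfolding subring_inclusion_def
    by (rule S.R.inclusion_ring_hom_cring) (simp_all add: S.R.carrier_is_subring)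
  show ?thesis
  proof (rule is_graded_ringI)
    show "cring ?E" by (rule E.R.is_cring)
    show piece: "additive_subgroup (piece ?E g) ?E" if "g \<in> carrier G" for g
    proof (rule E.additive_subgroup_inclusion)
      show "additive_subgroup (piece ?E g) S"
      proof (cases "g \<in> \<phi> ` carrier F")
        case True
        then show ?thesis using S.piece_subgroup by auto
      next
        case False
        then show ?thesis by (auto intro!: S.R.additive_subgroup_closedI)
      qed
      then show "piece ?E g \<subseteq> carrier ?E"
        by (simp add: additive_subgroup.a_subset)
    qed
    show "\<exists>A c. finite A \<and> A \<subseteq> carrier G \<and> (\<forall>g\<in>A. c g \<in> piece ?E g) \<and> x = finsum ?E c A"
      if "x \<in> carrier ?E" for x
    proof -
      from that have x: "x \<in> carrier S" by simp
      obtain A where A: "finite A" "A \<subseteq> carrier F" "x = finsum S (\<lambda>f. component F S f x) A"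
        using S.obtain_components[OF x] by metis
      define c where "c = (\<lambda>g. component F S (inv_into (carrier F) \<phi> g) x)"
      have c: "c (\<phi> f) = component F S f x" if "f \<in> carrier F" for f
        using that by (simp add: c_def inv_into_f_f[OF phi_inj])
      have "finsum S c (\<phi> ` A) = finsum S (\<lambda>f. c (\<phi> f)) A"
        using A c x S.component_carrier phi_inj
        by (intro S.R.finsum_reindex) (auto simp: subset_iff inj_on_def)
      also have "\<dots> = x"
        using A c x S.component_carrier by (subst A(3), intro S.R.finsum_cong') (auto simp: subset_iff)
      finally have "x = finsum ?E c (\<phi> ` A)"
        using A c x S.component_carrier by (subst E.finsum_inclusion) (auto simp: subset_iff)
      moreover have "\<forall>g\<in>\<phi> ` A. c g \<in> piece ?E g"
        using A c x S.component_piece by (auto simp: subset_iff)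
      moreover have "finite (\<phi> ` A)" "\<phi> ` A \<subseteq> carrier G"
        using A phi_closed by auto
      ultimately show ?thesis by blast
    qed
    show "c g = \<zero>\<^bsub>?E\<^esub>"
      if A: "finite A" "A \<subseteq> carrier G" "\<forall>g\<in>A. c g \<in> piece ?E g"
        and sum: "finsum ?E c A = \<zero>\<^bsub>?E\<^esub>" and g: "g \<in> A" for A c g
    proof (cases "g \<in> \<phi> ` carrier F")
      case True
      then obtain f where f: "f \<in> carrier F" "g = \<phi> f" by blast
      define B where "B = {f \<in> carrier F. \<phi> f \<in> A}"
      have inj: "inj_on \<phi> B" using phi_inj by (auto simp: B_def inj_on_def)
      have "\<phi> ` B \<subseteq> A" by (auto simp: B_def)
      then have B: "finite B" using A inj finite_imageD finite_subset by blast
      have cE: "c g \<in> carrier S" if "g \<in> A" for g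
        using A(2,3) additive_subgroup.a_Hcarr[OF piece, of g "c g"] that by auto
      have cB: "\<forall>f\<in>B. c (\<phi> f) \<in> piece S f"
        using A(3) by (fastforce simp: B_def)
      have "finsum S (\<lambda>f. c (\<phi> f)) B = finsum S c (\<phi> ` B)"
        using cE by (intro S.R.finsum_reindex[symmetric] inj) (auto simp: B_def)
      also have "\<dots> = finsum S c A"
      proof (rule S.R.add.finprod_mono_neutral_cong_left)
        show "c g = \<zero>\<^bsub>S\<^esub>" if "g \<in> A - \<phi> ` B" for g
        proof -
          have "g \<notin> \<phi> ` carrier F" using that by (auto simp: B_def)
          then show ?thesis using A(3) that by auto
        qed
      qed (use A cE in \<open>auto simp: B_def\<close>)
      also have "\<dots> = finsum ?E c A"
        by (rule E.finsum_inclusion[symmetric]) (use cE in simp)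
      also have "\<dots> = \<zero>\<^bsub>S\<^esub>" using sum by simp
      finally have "component F S f (finsum S (\<lambda>f. c (\<phi> f)) B) = \<zero>\<^bsub>S\<^esub>"
        using f by (simp add: S.component_zero)
      moreover have "f \<in> B" "B \<subseteq> carrier F" using f g by (auto simp: B_def)
      ultimately show ?thesis
        using S.component_finsum[OF B _ cB f(1)] f by simp
    next
      case False
      then show ?thesis using A(3) g by auto
    qed
    show "x \<otimes>\<^bsub>?E\<^esub> y \<in> piece ?E (g \<otimes>\<^bsub>G\<^esub> h)"
      if gh: "g \<in> carrier G" "h \<in> carrier G" and xy: "x \<in> piece ?E g" "y \<in> piece ?E h" for g h x y
    proof (cases "g \<in> \<phi> ` carrier F \<and> h \<in> \<phi> ` carrier F")
      case True
      then obtain k l where "k \<in> carrier F" "l \<in> carrier F" "g = \<phi> k" "h = \<phi> l" by blast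
      then show ?thesis using xy S.piece_mult by (simp add: phi_mult[symmetric])
    next
      case False
      have "x \<in> carrier S" "y \<in> carrier S"
        using gh xy additive_subgroup.a_Hcarr[OF piece] by auto
      moreover have "x = \<zero>\<^bsub>S\<^esub> \<or> y = \<zero>\<^bsub>S\<^esub>" using False xy by auto
      ultimately have "x \<otimes>\<^bsub>?E\<^esub> y = \<zero>\<^bsub>?E\<^esub>" by auto
      then show ?thesis
        using additive_subgroup.zero_closed[OF piece, of "g \<otimes>\<^bsub>G\<^esub> h"] gh by simp
    qed
  qed
qed

lemma restriction_carrier_sums:
  fixes R :: "('a, 'g) graded_ring" (structure)
  assumes "is_graded_ring G R"
  shows "carrier (restriction F \<phi> R) =
    {finsum R c A | A c. finite A \<and> A \<subseteq> carrier F \<and> (\<forall>f\<in>A. c f \<in> piece R (\<phi> f))}"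
proof -
  interpret graded_cring R G
    by (rule graded_cringI[OF G.is_group assms])
  show ?thesis
    unfolding restriction_def partial_object.simps
    by (rule R.family_sum_image) (use piece_subgroup phi_closed in blast)
qed

lemma component_finsum_phi:
  fixes R :: "('a, 'g) graded_ring" (structure)
  assumes "is_graded_ring G R"
    and A: "finite A" "A \<subseteq> carrier F" "\<forall>f\<in>A. c f \<in> piece R (\<phi> f)"
  shows "f \<in> carrier F \<Longrightarrow> component G R (\<phi> f) (finsum R c A) = (if f \<in> A then c f else \<zero>\<^bsub>R\<^esub>)"
    and "g \<in> carrier G - \<phi> ` carrier F \<Longrightarrow> component G R g (finsum R c A) = \<zero>\<^bsub>R\<^esub>"
proof -
  interpret graded_cring R G
    by (rule graded_cringI[OF G.is_group assms(1)])
  define d where "d = (\<lambda>g. c (inv_into (carrier F) \<phi> g))"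
  have d: "d (\<phi> f) = c f" if "f \<in> carrier F" for f
    using that by (simp add: d_def inv_into_f_f[OF phi_inj])
  have dA: "\<forall>g\<in>\<phi> ` A. d g \<in> piece R g" using A d by (auto simp: subset_iff)
  have phiA: "finite (\<phi> ` A)" "\<phi> ` A \<subseteq> carrier G" using A phi_closed by auto
  have "finsum R d (\<phi> ` A) = finsum R (\<lambda>f. d (\<phi> f)) A"
    using dA phiA A phi_inj piece_carrier by (intro R.finsum_reindex) (auto simp: inj_on_def subset_iff)
  also have "\<dots> = finsum R c A"
    using A d piece_carrier[OF phi_closed] by (intro R.finsum_cong') (auto simp: subset_iff)
  finally have eq: "finsum R c A = finsum R d (\<phi> ` A)" by simp
  show "component G R g (finsum R c A) = \<zero>" if "g \<in> carrier G - \<phi> ` carrier F"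
    using component_finsum[OF phiA dA, of g] that A by (auto simp: eq)
  show "component G R (\<phi> f) (finsum R c A) = (if f \<in> A then c f else \<zero>)" if "f \<in> carrier F"
  proof -
    have "\<phi> f \<in> \<phi> ` A \<longleftrightarrow> f \<in> A" using A that phi_inj by (auto simp: inj_on_def subset_iff)
    then show ?thesis using component_finsum[OF phiA dA, of "\<phi> f"] that d phi_closed by (simp add: eq)
  qed
qed

text \<open>A vanishing condition on components is additive, and multiplication by homogeneous factors
  with degrees in the image of \<open>\<phi>\<close> preserves it, so that in this form the restriction is seen to
  be a subring.\<close>
lemma restriction_carrier:
  fixes R :: "('a, 'g) graded_ring" (structure)
  assumes "is_graded_ring G R"
  shows "carrier (restriction F \<phi> R) =
    {x \<in> carrier R. \<forall>g\<in>carrier G - \<phi> ` carrier F. component G R g x = \<zero>\<^bsub>R\<^esub>}" (is "_ = ?K")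
proof -
  interpret graded_cring R G
    by (rule graded_cringI[OF G.is_group assms])
  show ?thesis
    unfolding restriction_carrier_sums[OF assms]
  proof (intro equalityI subsetI)
    fix x assume "x \<in> {finsum R c A | A c.
      finite A \<and> A \<subseteq> carrier F \<and> (\<forall>f\<in>A. c f \<in> piece R (\<phi> f))}"
    then obtain A c where A: "finite A" "A \<subseteq> carrier F" "\<forall>f\<in>A. c f \<in> piece R (\<phi> f)"
      and x: "x = finsum R c A" by blast
    have "x \<in> carrier R"
      unfolding x using A piece_carrier[OF phi_closed]
      by (intro R.finsum_closed) (auto simp: subset_iff)
    then show "x \<in> ?K" using component_finsum_phi(2)[OF assms A] x by simp
  next
    fix x assume x: "x \<in> ?K"
    then obtain A where A: "finite A" "A \<subseteq> carrier G"
        "x = finsum R (\<lambda>g. component G R g x) A"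
        "\<And>g. g \<in> carrier G \<Longrightarrow> component G R g x \<noteq> \<zero> \<longleftrightarrow> g \<in> A"
      using obtain_components[of x] by (metis (mono_tags, lifting) mem_Collect_eq)
    define B where "B = {f \<in> carrier F. \<phi> f \<in> A}"
    have inj: "inj_on \<phi> B" using phi_inj by (auto simp: B_def inj_on_def)
    have "A \<subseteq> \<phi> ` carrier F" using A(2,4) x by blast
    then have A_eq: "A = \<phi> ` B" by (auto simp: B_def)
    then have B: "finite B" using A(1) inj finite_imageD by blast
    have "(\<lambda>g. component G R g x) \<in> \<phi> ` B \<rightarrow> carrier R"
      using x component_carrier phi_closed by (auto simp: B_def)
    from R.finsum_reindex[OF this inj]
    have "x = finsum R (\<lambda>f. component G R (\<phi> f) x) B"
      using A(3) unfolding A_eq by simp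
    moreover have "\<forall>f\<in>B. component G R (\<phi> f) x \<in> piece R (\<phi> f)" "B \<subseteq> carrier F"
      using x component_piece phi_closed by (auto simp: B_def)
    ultimately show "x \<in> {finsum R c A | A c.
        finite A \<and> A \<subseteq> carrier F \<and> (\<forall>f\<in>A. c f \<in> piece R (\<phi> f))}"
      using B by blast
  qed
qed

lemma piece_restriction_subset:
  fixes R :: "('a, 'g) graded_ring" (structure)
  assumes "is_graded_ring G R" "f \<in> carrier F"
  shows "piece R (\<phi> f) \<subseteq> carrier (restriction F \<phi> R)"
proof -
  interpret graded_cring R G
    by (rule graded_cringI[OF G.is_group assms(1)])
  show ?thesis
    using assms(2) piece_carrier[of "\<phi> f"] phi_closed component_homogeneous[of "\<phi> f"]
    by (auto simp: restriction_carrier[OF assms(1)])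
qed

lemma restriction_subring:
  fixes R :: "('a, 'g) graded_ring" (structure)
  assumes "is_graded_ring G R"
  shows "subring (carrier (restriction F \<phi> R)) R"
proof -
  interpret graded_cring R G
    by (rule graded_cringI[OF G.is_group assms])
  let ?H = "carrier (restriction F \<phi> R)"
  note H = restriction_carrier[OF assms]
  have add_subgroup: "additive_subgroup ?H R"
    by (rule R.additive_subgroup_closedI)
      (auto simp: H component_zero component_add component_minus)
  show ?thesis
  proof (rule R.subringI)
    show "?H \<subseteq> carrier R" by (auto simp: H)
    show "\<one> \<in> ?H"
      using one_piece piece_restriction_subset[OF assms F.one_closed] by (auto simp: phi_one)
    show "\<ominus> x \<in> ?H" if "x \<in> ?H" for x
      using that by (auto simp: H component_minus)
    show "x \<oplus> y \<in> ?H" if "x \<in> ?H" "y \<in> ?H" for x y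
      using that by (auto simp: H component_add)
    show "x \<otimes> y \<in> ?H" if x: "x \<in> ?H" and y: "y \<in> ?H" for x y
    proof -
      from x obtain A c where A: "finite A" "A \<subseteq> carrier F" "\<forall>f\<in>A. c f \<in> piece R (\<phi> f)"
        and xsum: "x = finsum R c A"
        unfolding restriction_carrier_sums[OF assms] by blast
      have c: "c f \<in> carrier R" if "f \<in> A" for f
        using A that piece_carrier phi_closed by blast
      have yR: "y \<in> carrier R" using y by (simp add: H)
      have "x \<otimes> y = finsum R (\<lambda>f. c f \<otimes> y) A"
        unfolding xsum using A c yR by (intro R.finsum_ldistr) auto
      also have "\<dots> \<in> ?H"
      proof (rule R.additive_subgroup_finsum[OF add_subgroup])
        fix f assume f: "f \<in> A"
        then have fF: "f \<in> carrier F" using A by auto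
        have "component G R g (c f \<otimes> y) = \<zero>" if g: "g \<in> carrier G - \<phi> ` carrier F" for g
        proof -
          have "component G R g (c f \<otimes> y) =
              c f \<otimes> component G R (inv\<^bsub>G\<^esub> (\<phi> f) \<otimes>\<^bsub>G\<^esub> g) y"
            by (rule component_mult) (use A f fF phi_closed yR g in auto)
          also have "\<dots> = \<zero>"
            using image_translate[OF fF g] y c[OF f] by (simp add: H)
          finally show ?thesis .
        qed
        then show "c f \<otimes> y \<in> ?H" using c[OF f] yR by (simp add: H)
      qed
      finally show ?thesis .
    qed
  qed
qed

lemma restriction_inclusion:
  fixes R :: "('a, 'g) graded_ring" (structure)
  assumes "is_graded_ring G R"
  shows "subring_inclusion (restriction F \<phi> R) R"
proof -
  interpret graded_cring R G
    by (rule graded_cringI[OF G.is_group assms])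
  show ?thesis
    unfolding subring_inclusion_def
    by (rule R.inclusion_ring_hom_cring) (simp_all add: restriction_subring[OF assms])
qed

lemma restriction_graded:
  fixes R :: "('a, 'g) graded_ring" (structure)
  assumes "is_graded_ring G R"
  shows "is_graded_ring F (restriction F \<phi> R)"
proof -
  interpret graded_cring R G
    by (rule graded_cringI[OF G.is_group assms])
  let ?H = "restriction F \<phi> R"
  interpret H: subring_inclusion ?H R by (rule restriction_inclusion[OF assms])
  note piece = piece_restriction_subset[OF assms]
  have sum: "finsum ?H c A = finsum R c A"
    if "A \<subseteq> carrier F" "\<forall>f\<in>A. c f \<in> piece R (\<phi> f)" for A c
    using that piece by (intro H.finsum_inclusion) blast
  show ?thesis
  proof (rule is_graded_ringI)
    show "cring ?H" by (rule H.R.is_cring)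
    show "additive_subgroup (piece ?H f) ?H" if "f \<in> carrier F" for f
      using piece_subgroup[OF phi_closed[OF that]] piece[OF that]
      by (auto intro: H.additive_subgroup_inclusion)
    show "\<exists>A c. finite A \<and> A \<subseteq> carrier F \<and> (\<forall>f\<in>A. c f \<in> piece ?H f) \<and> x = finsum ?H c A"
      if x: "x \<in> carrier ?H" for x
    proof -
      from x obtain A c where "finite A" "A \<subseteq> carrier F" "\<forall>f\<in>A. c f \<in> piece R (\<phi> f)"
          "x = finsum R c A"
        unfolding restriction_carrier_sums[OF assms] by blast
      then show ?thesis using sum[of A c] by (intro exI[of _ A] exI[of _ c]) simp
    qed
    show "c f = \<zero>\<^bsub>?H\<^esub>"
      if A: "finite A" "A \<subseteq> carrier F" "\<forall>f\<in>A. c f \<in> piece ?H f"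
        and eq: "finsum ?H c A = \<zero>\<^bsub>?H\<^esub>" and f: "f \<in> A" for A c f
    proof -
      have "finsum R c A = \<zero>" using sum[of A c] A eq by simp
      then show ?thesis
        using component_finsum_phi(1)[OF assms A(1,2), of c f] A f phi_closed
        by (auto simp: component_zero)
    qed
    show "x \<otimes>\<^bsub>?H\<^esub> y \<in> piece ?H (f \<otimes>\<^bsub>F\<^esub> f')"
      if "f \<in> carrier F" "f' \<in> carrier F" "x \<in> piece ?H f" "y \<in> piece ?H f'" for f f' x y
      using that piece_mult phi_closed by (simp add: phi_mult)
  qed
qed

end

section \<open>Quotients by homogeneous ideals\<close>

lemma (in ring) quotient_ring_projection_hom:
  assumes "ideal I R"
  shows "projection R I \<in> ring_hom R (quotient_ring R I)"
    and "projection R I ` carrier R = carrier (quotient_ring R I)"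
    and "\<And>x. x \<in> carrier R \<Longrightarrow> projection R I x = \<zero>\<^bsub>quotient_ring R I\<^esub> \<longleftrightarrow> x \<in> I"
proof -
  interpret I: ideal I R by fact
  have iso: "coset_rep \<in> ring_iso (R Quot I) (quotient_ring R I)"
    by (rule quotient_ring_iso[OF assms])
  then have bij: "bij_betw coset_rep (carrier (R Quot I)) (carrier (quotient_ring R I))"
    by (simp add: ring_iso_def)
  have Quot: "carrier (R Quot I) = (+>) I ` carrier R"
    by (auto simp: FactRing_def A_RCOSETS_def')
  have "(coset_rep \<circ> (+>) I) \<in> ring_hom R (quotient_ring R I)"
    by (rule ring_hom_trans[OF I.rcos_ring_hom]) (use iso in \<open>simp add: ring_iso_def\<close>)
  moreover have "projection R I x = (coset_rep \<circ> (+>) I) x" if "x \<in> carrier R" for x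
    using that by (simp add: projection_def)
  ultimately show "projection R I \<in> ring_hom R (quotient_ring R I)"
    by (simp add: ring_hom_def Pi_def)
  show "projection R I ` carrier R = carrier (quotient_ring R I)"
    using bij_betw_imp_surj_on[OF bij] by (auto simp: Quot projection_def image_image)
  show "projection R I x = \<zero>\<^bsub>quotient_ring R I\<^esub> \<longleftrightarrow> x \<in> I" if x: "x \<in> carrier R" for x
  proof -
    have "\<zero>\<^bsub>quotient_ring R I\<^esub> = coset_rep (I +> \<zero>)"
      by (simp add: quotient_ring_def image_ring_zero FactRing_def a_rcos_zero[OF assms])
    then have "projection R I x = \<zero>\<^bsub>quotient_ring R I\<^esub> \<longleftrightarrow> I +> x = I +> \<zero>"
      using inj_onD[OF bij_betw_imp_inj_on[OF bij], of "I +> x" "I +> \<zero>"] x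
      by (auto simp: projection_def Quot)
    also have "\<dots> \<longleftrightarrow> x \<in> I"
      using x a_rcos_zero[OF assms] I.rcos_const_imp_mem I.zero_closed by metis
    finally show ?thesis .
  qed
qed

lemma (in cring) quotient_ring_cring:
  assumes "ideal I R"
  shows "cring (quotient_ring R I)"
proof -
  interpret I: ideal I R by fact
  interpret Q: cring "R Quot I" by (rule I.quotient_is_cring[OF is_cring])
  show ?thesis
    using Q.ring_iso_imp_img_cring[OF quotient_ring_iso[OF assms]]
    by (simp add: quotient_ring_def image_ring_def image_group_def monoid.defs)
qed

lemma graded_quotient_simps [simp]:
  "carrier (graded_quotient R I) = carrier (quotient_ring R I)"
  "monoid.mult (graded_quotient R I) = monoid.mult (quotient_ring R I)"
  "one (graded_quotient R I) = one (quotient_ring R I)"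
  "zero (graded_quotient R I) = zero (quotient_ring R I)"
  "add (graded_quotient R I) = add (quotient_ring R I)"
  "piece (graded_quotient R I) g = projection R I ` piece R g"
  by (simp_all add: graded_quotient_def)

lemma (in graded_cring) projection_hom:
  assumes "ideal I R"
  shows "ring_hom_cring R (graded_quotient R I) (projection R I)"
proof -
  interpret Q: cring "quotient_ring R I" by (rule R.quotient_ring_cring[OF assms])
  interpret inc: ring_hom_cring "graded_quotient R I" "quotient_ring R I" "\<lambda>x. x"
    by (rule Q.inclusion_ring_hom_cring) (simp_all add: Q.carrier_is_subring)
  have "projection R I \<in> ring_hom R (graded_quotient R I)"
    using R.quotient_ring_projection_hom(1)[OF assms] by (simp add: ring_hom_def)
  then show ?thesis
    by (simp add: ring_hom_cring_def ring_hom_cring_axioms_def R.is_cring inc.R.is_cring)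
qed

text \<open>Homogeneity of \<open>I\<close> is what independence in the quotient needs: if a sum of homogeneous
  representatives lies in \<open>I\<close>, then so does each of them.\<close>
lemma (in graded_cring) graded_quotient_graded:
  assumes I: "ideal I R"
    and homogeneous: "\<And>x g. x \<in> I \<Longrightarrow> g \<in> carrier G \<Longrightarrow> component G R g x \<in> I"
  shows "is_graded_ring G (graded_quotient R I)"
proof -
  let ?Q = "graded_quotient R I" and ?q = "projection R I"
  interpret q: ring_hom_cring R ?Q ?q by (rule projection_hom[OF I])
  note surj = R.quotient_ring_projection_hom(2)[OF I]
  note ker = R.quotient_ring_projection_hom(3)[OF I]
  show ?thesis
  proof (rule is_graded_ringI)
    show "cring ?Q" by (rule q.S.is_cring)
    show "additive_subgroup (piece ?Q g) ?Q" if "g \<in> carrier G" for g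
      using q.image_additive_subgroup[OF piece_subgroup[OF that]] by simp
    show "\<exists>A c. finite A \<and> A \<subseteq> carrier G \<and> (\<forall>g\<in>A. c g \<in> piece ?Q g) \<and> y = finsum ?Q c A"
      if "y \<in> carrier ?Q" for y
    proof -
      from that surj obtain x where x: "x \<in> carrier R" "y = ?q x" by auto
      obtain A where A: "finite A" "A \<subseteq> carrier G" "x = finsum R (\<lambda>g. component G R g x) A"
        using obtain_components[OF x(1)] by metis
      have "y = ?q (finsum R (\<lambda>g. component G R g x) A)" using x(2) A(3) by simp
      also have "\<dots> = finsum ?Q (?q \<circ> (\<lambda>g. component G R g x)) A"
        by (rule q.hom_finsum) (use A x component_carrier in auto)
      finally have "y = finsum ?Q (?q \<circ> (\<lambda>g. component G R g x)) A" .
      moreover have "\<forall>g\<in>A. (?q \<circ> (\<lambda>g. component G R g x)) g \<in> piece ?Q g"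
        using A x component_piece by auto
      ultimately show ?thesis using A by blast
    qed
    show "c g = \<zero>\<^bsub>?Q\<^esub>"
      if A: "finite A" "A \<subseteq> carrier G" "\<forall>g\<in>A. c g \<in> piece ?Q g"
        and sum: "finsum ?Q c A = \<zero>\<^bsub>?Q\<^esub>" and g: "g \<in> A" for A c g
    proof -
      from A(3) have "\<forall>g\<in>A. \<exists>x. x \<in> piece R g \<and> c g = ?q x" by auto
      then obtain d where d: "\<forall>g\<in>A. d g \<in> piece R g \<and> c g = ?q (d g)" by metis
      then have dR: "d \<in> A \<rightarrow> carrier R" using A piece_carrier by blast
      have "?q (finsum R d A) = finsum ?Q (?q \<circ> d) A"
        by (rule q.hom_finsum[OF dR])
      also have "\<dots> = finsum ?Q c A"
        using d dR A
        by (intro q.S.finsum_cong') (auto simp: Pi_def simp del: graded_quotient_simps(1))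
      finally have "?q (finsum R d A) = \<zero>\<^bsub>quotient_ring R I\<^esub>" using sum by simp
      then have "finsum R d A \<in> I" using ker R.finsum_closed[OF dR] by blast
      from homogeneous[OF this, of g] have "d g \<in> I"
        using component_finsum[OF A(1,2), of d g] d g A(2) by auto
      then show ?thesis using ker[of "d g"] dR d g by auto
    qed
    show "x \<otimes>\<^bsub>?Q\<^esub> y \<in> piece ?Q (g \<otimes>\<^bsub>G\<^esub> h)"
      if gh: "g \<in> carrier G" "h \<in> carrier G" and xy: "x \<in> piece ?Q g" "y \<in> piece ?Q h" for g h x y
    proof -
      from xy obtain a b where ab: "a \<in> piece R g" "b \<in> piece R h" "x = ?q a" "y = ?q b" by auto
      then have "x \<otimes>\<^bsub>?Q\<^esub> y = ?q (a \<otimes> b)"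
        using gh piece_carrier by (metis q.hom_mult)
      then show ?thesis using piece_mult[OF gh ab(1,2)] by simp
    qed
  qed
qed

text \<open>The elements whose components all lie in the generated ideal form an ideal containing
  the generators, so they contain the generated ideal by minimality. Stability under multiplication by
  an arbitrary element reduces to homogeneous factors, which only shift components.\<close>
lemma (in graded_cring) homogeneous_genideal:
  assumes N: "N \<subseteq> carrier G" and x: "x \<in> Idl\<^bsub>R\<^esub> (\<Union>g\<in>N. piece R g)" and g: "g \<in> carrier G"
  shows "component G R g x \<in> Idl\<^bsub>R\<^esub> (\<Union>g\<in>N. piece R g)"
proof -
  let ?X = "\<Union>g\<in>N. piece R g" and ?I = "Idl\<^bsub>R\<^esub> (\<Union>g\<in>N. piece R g)"
  have X: "?X \<subseteq> carrier R" using N piece_carrier by blast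
  interpret I: ideal ?I R by (rule R.genideal_ideal[OF X])
  define J where "J = {x \<in> carrier R. \<forall>g\<in>carrier G. component G R g x \<in> ?I}"
  have J: "additive_subgroup J R"
    by (rule R.additive_subgroup_closedI)
      (auto simp: J_def component_zero component_add component_minus I.a_closed I.a_inv_closed
        I.zero_closed)
  have mult: "r \<otimes> x \<in> J" if x: "x \<in> J" and r: "r \<in> carrier R" for x r
  proof -
    have xR: "x \<in> carrier R" using x by (simp add: J_def)
    obtain A where A: "finite A" "A \<subseteq> carrier G" "r = finsum R (\<lambda>g. component G R g r) A"
      using obtain_components[OF r] by metis
    have "r \<otimes> x = finsum R (\<lambda>g. component G R g r) A \<otimes> x" using A(3) by simp
    also have "\<dots> = finsum R (\<lambda>g. component G R g r \<otimes> x) A"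
      using A(1,2) r xR component_carrier by (intro R.finsum_ldistr) auto
    also have "\<dots> \<in> J"
    proof (rule R.additive_subgroup_finsum[OF J])
      fix h assume "h \<in> A"
      then have h: "h \<in> carrier G" using A by auto
      have "component G R g (component G R h r \<otimes> x) \<in> ?I" if g: "g \<in> carrier G" for g
        using component_mult[OF h component_piece[OF r h] xR g] x r h g component_carrier
        by (simp add: J_def I.I_l_closed)
      then show "component G R h r \<otimes> x \<in> J"
        using component_carrier[OF r h] xR by (simp add: J_def)
    qed
    finally show ?thesis .
  qed
  have "ideal J R"
  proof (rule idealI[OF R.ring_axioms])
    show "subgroup J (add_monoid R)" using J by (rule additive_subgroup.a_subgroup)
    show "r \<otimes> x \<in> J" if "x \<in> J" "r \<in> carrier R" for x r using that by (rule mult)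
    show "x \<otimes> r \<in> J" if "x \<in> J" "r \<in> carrier R" for x r
      using mult[OF that] that R.m_comm[of x r] by (simp add: J_def)
  qed
  moreover have "?X \<subseteq> J"
  proof
    fix y assume y: "y \<in> ?X"
    then obtain h where h: "h \<in> carrier G" "y \<in> piece R h" using N by blast
    then have "component G R g y \<in> ?I" if "g \<in> carrier G" for g
      using R.genideal_self[OF X] y that by (auto simp: component_homogeneous I.zero_closed)
    then show "y \<in> J" using y X by (auto simp: J_def)
  qed
  ultimately have "?I \<subseteq> J" by (rule R.genideal_minimal)
  then show ?thesis using x g by (auto simp: J_def)
qed

section \<open>Corestriction\<close>

context group_mono
begin

lemma corestriction_ideal:
  assumes "is_graded_ring G R"
  shows "ideal (corestriction_ideal F G \<phi> R) R"
    and "\<And>g. g \<in> carrier G - \<phi> ` carrier F \<Longrightarrow> piece R g \<subseteq> corestriction_ideal F G \<phi> R"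
proof -
  interpret graded_cring R G
    by (rule graded_cringI[OF G.is_group assms])
  have X: "(\<Union>g\<in>carrier G - \<phi> ` carrier F. piece R g) \<subseteq> carrier R"
    using piece_carrier by blast
  show "ideal (corestriction_ideal F G \<phi> R) R"
    unfolding corestriction_ideal_def by (rule R.genideal_ideal[OF X])
  show "piece R g \<subseteq> corestriction_ideal F G \<phi> R" if "g \<in> carrier G - \<phi> ` carrier F" for g
    using R.genideal_self[OF X] that unfolding corestriction_ideal_def by blast
qed

lemma quotient_graded:
  assumes "is_graded_ring G R"
  shows "is_graded_ring G (graded_quotient R (corestriction_ideal F G \<phi> R))"
proof -
  interpret graded_cring R G
    by (rule graded_cringI[OF G.is_group assms])
  show ?thesis
    by (rule graded_quotient_graded[OF corestriction_ideal(1)[OF assms]])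
      (auto simp: corestriction_ideal_def intro: homogeneous_genideal[of "carrier G - \<phi> ` carrier F"])
qed

lemma alpha_eq_zero_iff:
  assumes "is_graded_ring G R" "x \<in> carrier R"
  shows "alpha F G \<phi> R x = zero (corestriction F G \<phi> R) \<longleftrightarrow> x \<in> corestriction_ideal F G \<phi> R"
proof -
  interpret graded_cring R G
    by (rule graded_cringI[OF G.is_group assms(1)])
  show ?thesis
    using R.quotient_ring_projection_hom(3)[OF corestriction_ideal(1)[OF assms(1)] assms(2)]
    by (simp add: alpha_def corestriction_def)
qed

text \<open>In the quotient by the corestriction ideal the pieces outside the image of \<open>\<phi>\<close> vanish, so
  that restriction does not shrink the quotient.\<close>
lemma carrier_corestriction:
  assumes "is_graded_ring G R"
  shows "carrier (corestriction F G \<phi> R) = alpha F G \<phi> R ` carrier R"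
proof -
  interpret graded_cring R G
    by (rule graded_cringI[OF G.is_group assms])
  let ?I = "corestriction_ideal F G \<phi> R"
  let ?Q = "graded_quotient R ?I"
  note I = corestriction_ideal[OF assms]
  interpret Q: graded_cring ?Q G
    by (rule graded_cringI[OF G.is_group quotient_graded[OF assms]])
  have "component G ?Q g y = \<zero>\<^bsub>?Q\<^esub>"
    if y: "y \<in> carrier ?Q" and g: "g \<in> carrier G - \<phi> ` carrier F" for y g
  proof -
    have "component G ?Q g y \<in> projection R ?I ` piece R g"
      using Q.component_piece[OF y] g by simp
    then obtain x where x: "x \<in> piece R g" "component G ?Q g y = projection R ?I x" by blast
    then have "x \<in> carrier R" "x \<in> ?I" using piece_carrier g I(2) by blast+
    then show ?thesis
      using x alpha_eq_zero_iff[OF assms, of x] by (simp add: alpha_def corestriction_def)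
  qed
  then have "carrier (corestriction F G \<phi> R) = carrier ?Q"
    by (auto simp: corestriction_def restriction_carrier[OF quotient_graded[OF assms]])
  then show ?thesis
    using R.quotient_ring_projection_hom(2)[OF I(1)] by (simp add: alpha_def)
qed

lemma corestriction_graded:
  "is_graded_ring G R \<Longrightarrow> is_graded_ring F (corestriction F G \<phi> R)"
  unfolding corestriction_def by (intro restriction_graded quotient_graded)

lemma piece_corestriction [simp]:
  "piece (corestriction F G \<phi> R) f = alpha F G \<phi> R ` piece R (\<phi> f)"
  by (simp add: corestriction_def alpha_def)

lemma alpha_ring_hom:
  assumes "is_graded_ring G R"
  shows "alpha F G \<phi> R \<in> ring_hom R (corestriction F G \<phi> R)"
proof -
  interpret graded_cring R G
    by (rule graded_cringI[OF G.is_group assms])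
  have "projection R (corestriction_ideal F G \<phi> R)
      \<in> ring_hom R (quotient_ring R (corestriction_ideal F G \<phi> R))"
    by (rule R.quotient_ring_projection_hom(1)[OF corestriction_ideal(1)[OF assms]])
  then show ?thesis
    using carrier_corestriction[OF assms]
    by (auto simp: ring_hom_def alpha_def corestriction_def)
qed

text \<open>The pieces of an extension outside the image of \<open>\<phi>\<close> are zero, so the ideal is zero, every coset
  is a singleton, and the chosen representative of a coset is its only element.\<close>
lemma alpha_extension:
  assumes "is_graded_ring F S" "x \<in> carrier S"
  shows "alpha F G \<phi> (extension F \<phi> S) x = x"
proof -
  let ?E = "extension F \<phi> S"
  interpret E: graded_cring ?E G
    by (rule graded_cringI[OF G.is_group extension_graded[OF assms(1)]])
  have "corestriction_ideal F G \<phi> ?E \<subseteq> {\<zero>\<^bsub>?E\<^esub>}"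
    unfolding corestriction_ideal_def
    by (rule E.R.genideal_minimal[OF E.R.zeroideal]) auto
  moreover have "\<zero>\<^bsub>?E\<^esub> \<in> corestriction_ideal F G \<phi> ?E"
    using ideal.axioms(1)[OF corestriction_ideal(1)[OF extension_graded[OF assms(1)]]]
    by (rule additive_subgroup.zero_closed)
  ultimately have zero: "corestriction_ideal F G \<phi> ?E = {\<zero>\<^bsub>?E\<^esub>}" by blast
  have xE: "x \<in> carrier ?E" using assms by simp
  have "{\<zero>\<^bsub>?E\<^esub>} +>\<^bsub>?E\<^esub> x = {x}"
    using E.R.l_zero[OF xE] by (simp add: a_r_coset_def r_coset_def)
  then show ?thesis
    using xE by (simp add: alpha_def projection_def zero coset_rep_def)
qed

end

section \<open>The category of graded rings\<close>

lemma Ann_simps [simp]: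
  "obj (Ann G) = {R. is_graded_ring G R}"
  "hom_set (Ann G) = graded_hom G"
  "ident (Ann G) R = (\<lambda>x\<in>carrier R. x)"
  "comp (Ann G) R S T v u = compose (carrier R) v u"
  by (simp_all add: Ann_def)

lemma graded_ring_cring: "is_graded_ring G R \<Longrightarrow> cring R"
  by (simp add: is_graded_ring_def)

lemma graded_ring_piece_carrier:
  "is_graded_ring G R \<Longrightarrow> g \<in> carrier G \<Longrightarrow> x \<in> piece R g \<Longrightarrow> x \<in> carrier R"
  by (auto simp: is_graded_ring_def intro: additive_subgroup.a_Hcarr)

lemma graded_homD:
  assumes "u \<in> graded_hom G R S"
  shows "u \<in> ring_hom R S" "u \<in> extensional (carrier R)"
    and "\<And>x. x \<in> carrier R \<Longrightarrow> u x \<in> carrier S"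
    and "\<And>g x. g \<in> carrier G \<Longrightarrow> x \<in> piece R g \<Longrightarrow> u x \<in> piece S g"
  using assms by (auto simp: graded_hom_def ring_hom_def image_subset_iff)

lemma graded_hom_ring_hom_cring:
  assumes "u \<in> graded_hom G R S" "cring R" "cring S"
  shows "ring_hom_cring R S u"
  using assms by (simp add: graded_homD ring_hom_cring_def ring_hom_cring_axioms_def)

lemma graded_hom_zero:
  assumes "u \<in> graded_hom G R S" "cring R" "cring S"
  shows "u \<zero>\<^bsub>R\<^esub> = \<zero>\<^bsub>S\<^esub>"
  using ring_hom_cring.hom_zero[OF graded_hom_ring_hom_cring[OF assms]] .

lemma restrict_graded_hom:
  assumes "is_graded_ring G R" and u: "u \<in> ring_hom R S"
    and piece: "\<And>g x. g \<in> carrier G \<Longrightarrow> x \<in> piece R g \<Longrightarrow> u x \<in> piece S g"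
  shows "restrict u (carrier R) \<in> graded_hom G R S"
proof -
  interpret cring R using assms(1) by (rule graded_ring_cring)
  show ?thesis
    using u piece graded_ring_piece_carrier[OF assms(1)]
    by (auto simp: graded_hom_def ring_hom_def)
qed

lemma identity_graded_hom:
  assumes "is_graded_ring G R"
  shows "(\<lambda>x\<in>carrier R. x) \<in> graded_hom G R R"
  by (rule restrict_graded_hom[OF assms]) (auto simp: ring_hom_def)

lemma same_graded_ring_identity:
  assumes R: "is_graded_ring G R" and S: "is_graded_ring G S" and same: "same_graded_ring G R S"
  shows "(\<lambda>x\<in>carrier R. x) \<in> graded_hom G R S" and "(\<lambda>x\<in>carrier R. x) \<in> graded_hom G S R"
proof -
  have carrier: "carrier S = carrier R" using same by (simp add: same_graded_ring_def)
  show "(\<lambda>x\<in>carrier R. x) \<in> graded_hom G R S"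
    by (rule restrict_graded_hom[OF R]) (use same in \<open>auto simp: same_graded_ring_def ring_hom_def\<close>)
  show "(\<lambda>x\<in>carrier R. x) \<in> graded_hom G S R"
    unfolding carrier[symmetric]
    by (rule restrict_graded_hom[OF S]) (use same in \<open>auto simp: same_graded_ring_def ring_hom_def\<close>)
qed

lemma compose_graded_hom:
  assumes "is_graded_ring G R" "u \<in> graded_hom G R S" "v \<in> graded_hom G S T"
  shows "compose (carrier R) v u \<in> graded_hom G R T"
  unfolding compose_def
proof (rule restrict_graded_hom[OF assms(1)])
  show "(\<lambda>x. v (u x)) \<in> ring_hom R T"
    using ring_hom_trans[OF graded_homD(1)[OF assms(2)] graded_homD(1)[OF assms(3)]]
    by (simp add: o_def)
  show "v (u x) \<in> piece T g" if "g \<in> carrier G" "x \<in> piece R g" for g x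
    using that graded_homD(4) assms by metis
qed

lemma Ann_category: "is_category (Ann G)"
  unfolding is_category_def Ann_simps mem_Collect_eq Ball_def
proof (intro conjI allI impI)
  show "compose (carrier R) u (\<lambda>x\<in>carrier R. x) = u"
    and "compose (carrier R) (\<lambda>x\<in>carrier S. x) u = u"
    if "u \<in> graded_hom G R S" for R S u
    using graded_homD(2,3)[OF that] by (auto simp: compose_def fun_eq_iff extensional_def)
  show "compose (carrier R) (compose (carrier S) w v) u = compose (carrier R) w (compose (carrier R) v u)"
    if "u \<in> graded_hom G R S" for R S u v w
    using graded_homD(3)[OF that] by (auto simp: compose_def fun_eq_iff)
qed (auto intro: identity_graded_hom compose_graded_hom)

lemma id_functor_is_functor: "is_category C \<Longrightarrow> is_functor C C id_functor"
  by (simp add: is_functor_def id_functor_def)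

lemma comp_functor_is_functor:
  assumes "is_functor C D S" "is_functor D E T"
  shows "is_functor C E (T \<circ>\<^sub>F S)"
  using assms unfolding is_functor_def comp_functor_def by simp

text \<open>Morphisms of graded rings are extensional, so equations between them need to be checked only on
  elements of the carrier; the same applies to adjunctions below.\<close>
lemma Ann_functorI:
  assumes "\<And>R. is_graded_ring G R \<Longrightarrow> is_graded_ring H (fobj T R)"
    and "\<And>R S u. is_graded_ring G R \<Longrightarrow> is_graded_ring G S \<Longrightarrow> u \<in> graded_hom G R S \<Longrightarrow>
      fmap T R S u \<in> graded_hom H (fobj T R) (fobj T S)"
    and "\<And>R x. is_graded_ring G R \<Longrightarrow> x \<in> carrier (fobj T R) \<Longrightarrow>
      fmap T R R (\<lambda>x\<in>carrier R. x) x = x"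
    and "\<And>Q R S u v x. is_graded_ring G Q \<Longrightarrow> is_graded_ring G R \<Longrightarrow> is_graded_ring G S \<Longrightarrow>
      u \<in> graded_hom G Q R \<Longrightarrow> v \<in> graded_hom G R S \<Longrightarrow> x \<in> carrier (fobj T Q) \<Longrightarrow>
      fmap T Q S (compose (carrier Q) v u) x = fmap T R S v (fmap T Q R u x)"
  shows "is_functor (Ann G) (Ann H) T"
  unfolding is_functor_def Ann_simps mem_Collect_eq Ball_def
proof (intro conjI allI impI Ann_category)
  show "fmap T R R (\<lambda>x\<in>carrier R. x) = (\<lambda>x\<in>carrier (fobj T R). x)"
    if R: "is_graded_ring G R" for R
  proof (rule extensionalityI[of _ "carrier (fobj T R)"])
    show "fmap T R R (\<lambda>x\<in>carrier R. x) \<in> extensional (carrier (fobj T R))"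
      using assms(2)[OF R R identity_graded_hom[OF R]] by (rule graded_homD)
  qed (use assms(3) R in auto)
  show "fmap T Q S (compose (carrier Q) v u) =
      compose (carrier (fobj T Q)) (fmap T R S v) (fmap T Q R u)"
    if *: "is_graded_ring G Q" "is_graded_ring G R" "is_graded_ring G S"
      "u \<in> graded_hom G Q R" "v \<in> graded_hom G R S" for Q R S u v
  proof (rule extensionalityI[of _ "carrier (fobj T Q)"])
    show "fmap T Q S (compose (carrier Q) v u) \<in> extensional (carrier (fobj T Q))"
      using assms(2)[OF *(1,3) compose_graded_hom[OF *(1,4,5)]] by (rule graded_homD)
  qed (use assms(4) * in \<open>auto simp: compose_def\<close>)
qed (use assms(1,2) in auto)

lemma Ann_adjunctionI:
  assumes L: "is_functor (Ann G) (Ann H) L" and M: "is_functor (Ann H) (Ann G) M"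
    and \<eta>: "\<And>R. is_graded_ring G R \<Longrightarrow> \<eta> R \<in> graded_hom G R (fobj M (fobj L R))"
    and \<epsilon>: "\<And>S. is_graded_ring H S \<Longrightarrow> \<epsilon> S \<in> graded_hom H (fobj L (fobj M S)) S"
    and \<eta>_nat: "\<And>R S u x. is_graded_ring G R \<Longrightarrow> is_graded_ring G S \<Longrightarrow> u \<in> graded_hom G R S \<Longrightarrow>
      x \<in> carrier R \<Longrightarrow> fmap M (fobj L R) (fobj L S) (fmap L R S u) (\<eta> R x) = \<eta> S (u x)"
    and \<epsilon>_nat: "\<And>R S u x. is_graded_ring H R \<Longrightarrow> is_graded_ring H S \<Longrightarrow> u \<in> graded_hom H R S \<Longrightarrow>
      x \<in> carrier (fobj L (fobj M R)) \<Longrightarrow>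
      u (\<epsilon> R x) = \<epsilon> S (fmap L (fobj M R) (fobj M S) (fmap M R S u) x)"
    and triangle1: "\<And>R x. is_graded_ring G R \<Longrightarrow> x \<in> carrier (fobj L R) \<Longrightarrow>
      \<epsilon> (fobj L R) (fmap L R (fobj M (fobj L R)) (\<eta> R) x) = x"
    and triangle2: "\<And>S x. is_graded_ring H S \<Longrightarrow> x \<in> carrier (fobj M S) \<Longrightarrow>
      fmap M (fobj L (fobj M S)) S (\<epsilon> S) (\<eta> (fobj M S) x) = x"
  shows "adjunction (Ann G) (Ann H) L M \<eta> \<epsilon>"
proof -
  note functors = L M id_functor_is_functor[OF Ann_category]
    comp_functor_is_functor[OF L M] comp_functor_is_functor[OF M L]
  have "natural_transformation (Ann G) (Ann G) id_functor (M \<circ>\<^sub>F L) \<eta>"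
    unfolding natural_transformation_def
    using functors \<eta> \<eta>_nat
    by (auto simp: id_functor_def comp_functor_def compose_def intro!: restrict_ext)
  moreover have "natural_transformation (Ann H) (Ann H) (L \<circ>\<^sub>F M) id_functor \<epsilon>"
    unfolding natural_transformation_def
    using functors \<epsilon> \<epsilon>_nat
    by (auto simp: id_functor_def comp_functor_def compose_def intro!: restrict_ext)
  ultimately show ?thesis
    unfolding adjunction_def
    using L M triangle1 triangle2 by (auto simp: compose_def intro!: restrict_ext)
qed

section \<open>The three functors\<close>

context group_mono
begin

lemma alpha_ring_hom_cring:
  assumes "is_graded_ring G R"
  shows "ring_hom_cring R (corestriction F G \<phi> R) (alpha F G \<phi> R)"
  using alpha_ring_hom[OF assms] graded_ring_cring[OF assms]
    graded_ring_cring[OF corestriction_graded[OF assms]]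
  by (simp add: ring_hom_cring_def ring_hom_cring_axioms_def)

lemma hom_corestriction_ideal:
  assumes R: "is_graded_ring G R" and S: "is_graded_ring G S" and u: "u \<in> graded_hom G R S"
    and x: "x \<in> corestriction_ideal F G \<phi> R"
  shows "u x \<in> corestriction_ideal F G \<phi> S"
proof -
  interpret u: ring_hom_cring R S u
    using graded_hom_ring_hom_cring[OF u graded_ring_cring graded_ring_cring] R S by blast
  have hom: "ring_hom_ring R S u"
    by (rule ring_hom_ringI2[OF u.R.ring_axioms u.S.ring_axioms u.homh])
  let ?J = "{r \<in> carrier R. u r \<in> corestriction_ideal F G \<phi> S}"
  have "ideal ?J R"
    by (rule ring_hom_ring.ideal_vimage[OF hom corestriction_ideal(1)[OF S]])
  moreover have "(\<Union>g\<in>carrier G - \<phi> ` carrier F. piece R g) \<subseteq> ?J"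
    using graded_homD(4)[OF u] graded_ring_piece_carrier[OF R] corestriction_ideal(2)[OF S]
    by blast
  ultimately have "corestriction_ideal F G \<phi> R \<subseteq> ?J"
    unfolding corestriction_ideal_def[of F G \<phi> R] by (rule u.R.genideal_minimal)
  then show ?thesis using x by blast
qed

text \<open>The preimage chosen in the definition of the functor differs from \<open>x\<close> by an element of the
  corestriction ideal, which \<open>u\<close> maps into the corestriction ideal of \<open>S\<close>. As \<open>alpha\<close> is onto,
  this equation determines the induced map; it also is the naturality of \<open>alpha\<close>.\<close>
lemma corestriction_map:
  assumes R: "is_graded_ring G R" and S: "is_graded_ring G S" and u: "u \<in> graded_hom G R S"
    and x: "x \<in> carrier R"
  shows "fmap (corestriction_functor F G \<phi>) R S u (alpha F G \<phi> R x) = alpha F G \<phi> S (u x)"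
proof -
  interpret a: ring_hom_cring R "corestriction F G \<phi> R" "alpha F G \<phi> R"
    by (rule alpha_ring_hom_cring[OF R])
  interpret b: ring_hom_cring S "corestriction F G \<phi> S" "alpha F G \<phi> S"
    by (rule alpha_ring_hom_cring[OF S])
  interpret u: ring_hom_cring R S u
    by (rule graded_hom_ring_hom_cring[OF u a.R.is_cring b.R.is_cring])
  define y where "y = inv_into (carrier R) (alpha F G \<phi> R) (alpha F G \<phi> R x)"
  have y: "y \<in> carrier R" "alpha F G \<phi> R y = alpha F G \<phi> R x"
    unfolding y_def using x by (simp_all add: inv_into_into f_inv_into_f)
  have diff: "y \<ominus>\<^bsub>R\<^esub> x \<in> carrier R" using y(1) x by (rule a.R.minus_closed)
  have "alpha F G \<phi> R (y \<ominus>\<^bsub>R\<^esub> x) = \<zero>\<^bsub>corestriction F G \<phi> R\<^esub>"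
    using a.hom_eq_iff[OF y(1) x] y(2) by blast
  then have "y \<ominus>\<^bsub>R\<^esub> x \<in> corestriction_ideal F G \<phi> R"
    using alpha_eq_zero_iff[OF R diff] by blast
  then have "u (y \<ominus>\<^bsub>R\<^esub> x) \<in> corestriction_ideal F G \<phi> S"
    by (rule hom_corestriction_ideal[OF R S u])
  then have "alpha F G \<phi> S (u (y \<ominus>\<^bsub>R\<^esub> x)) = \<zero>\<^bsub>corestriction F G \<phi> S\<^esub>"
    using alpha_eq_zero_iff[OF S u.hom_closed[OF diff]] by blast
  moreover have "u (y \<ominus>\<^bsub>R\<^esub> x) = u y \<ominus>\<^bsub>S\<^esub> u x"
    using y(1) x by (simp add: a.R.minus_eq b.R.minus_eq)
  ultimately have "alpha F G \<phi> S (u y) = alpha F G \<phi> S (u x)"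
    using b.hom_eq_iff[OF u.hom_closed[OF y(1)] u.hom_closed[OF x]] by metis
  then show ?thesis
    using carrier_corestriction[OF R] x
    by (simp add: corestriction_functor_def y_def alpha_def)
qed

lemma corestriction_is_functor:
  "is_functor (Ann G) (Ann F) (corestriction_functor F G \<phi>)"
proof -
  let ?T = "corestriction_functor F G \<phi>"
  have obj: "fobj ?T R = corestriction F G \<phi> R" for R :: "('a, 'g) graded_ring"
    by (simp add: corestriction_functor_def)
  have ext: "fmap ?T R S u = restrict (fmap ?T R S u) (carrier (corestriction F G \<phi> R))"
    for R S :: "('a, 'g) graded_ring" and u
    by (simp add: corestriction_functor_def restrict_def fun_eq_iff)
  show ?thesis
  proof (rule Ann_functorI, unfold obj)
    fix R :: "('a, 'g) graded_ring" assume R: "is_graded_ring G R"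
    show "is_graded_ring F (corestriction F G \<phi> R)" by (rule corestriction_graded[OF R])
    show "fmap ?T R R (\<lambda>x\<in>carrier R. x) y = y" if "y \<in> carrier (corestriction F G \<phi> R)" for y
      using that corestriction_map[OF R R identity_graded_hom[OF R]]
      by (auto simp: carrier_corestriction[OF R])
  next
    fix R S :: "('a, 'g) graded_ring" and u
    assume R: "is_graded_ring G R" and S: "is_graded_ring G S" and u: "u \<in> graded_hom G R S"
    interpret a: ring_hom_cring R "corestriction F G \<phi> R" "alpha F G \<phi> R"
      by (rule alpha_ring_hom_cring[OF R])
    interpret b: ring_hom_cring S "corestriction F G \<phi> S" "alpha F G \<phi> S"
      by (rule alpha_ring_hom_cring[OF S])
    interpret u: ring_hom_cring R S u
      by (rule graded_hom_ring_hom_cring[OF u a.R.is_cring b.R.is_cring])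
    note map = corestriction_map[OF R S u]
    show "fmap ?T R S u \<in> graded_hom F (corestriction F G \<phi> R) (corestriction F G \<phi> S)"
    proof (subst ext, rule restrict_graded_hom[OF corestriction_graded[OF R]])
      show "fmap ?T R S u \<in> ring_hom (corestriction F G \<phi> R) (corestriction F G \<phi> S)"
      proof (rule ring_hom_memI)
        fix y z assume yz: "y \<in> carrier (corestriction F G \<phi> R)" "z \<in> carrier (corestriction F G \<phi> R)"
        then obtain a b where ab: "a \<in> carrier R" "y = alpha F G \<phi> R a"
          "b \<in> carrier R" "z = alpha F G \<phi> R b"
          unfolding carrier_corestriction[OF R] by blast
        show "fmap ?T R S u y \<in> carrier (corestriction F G \<phi> S)"
          using ab by (simp add: map)
        show "fmap ?T R S u (y \<otimes>\<^bsub>corestriction F G \<phi> R\<^esub> z) =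
            fmap ?T R S u y \<otimes>\<^bsub>corestriction F G \<phi> S\<^esub> fmap ?T R S u z"
          using ab by (simp add: map a.hom_mult[symmetric] del: a.hom_mult)
        show "fmap ?T R S u (y \<oplus>\<^bsub>corestriction F G \<phi> R\<^esub> z) =
            fmap ?T R S u y \<oplus>\<^bsub>corestriction F G \<phi> S\<^esub> fmap ?T R S u z"
          using ab by (simp add: map a.hom_add[symmetric] del: a.hom_add)
      next
        show "fmap ?T R S u \<one>\<^bsub>corestriction F G \<phi> R\<^esub> = \<one>\<^bsub>corestriction F G \<phi> S\<^esub>"
          using map[OF a.R.one_closed] by simp
      qed
      show "fmap ?T R S u y \<in> piece (corestriction F G \<phi> S) f"
        if "f \<in> carrier F" "y \<in> piece (corestriction F G \<phi> R) f" for f y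
      proof -
        from that obtain x where "x \<in> piece R (\<phi> f)" "y = alpha F G \<phi> R x" by auto
        moreover have "\<phi> f \<in> carrier G" using that(1) by (rule phi_closed)
        ultimately show ?thesis
          using graded_homD(4)[OF u] graded_ring_piece_carrier[OF R] by (auto simp: map)
      qed
    qed
  next
    fix Q R S :: "('a, 'g) graded_ring" and u v y
    assume Q: "is_graded_ring G Q" and R: "is_graded_ring G R" and S: "is_graded_ring G S"
      and u: "u \<in> graded_hom G Q R" and v: "v \<in> graded_hom G R S"
      and "y \<in> carrier (corestriction F G \<phi> Q)"
    then obtain x where "x \<in> carrier Q" "y = alpha F G \<phi> Q x"
      by (auto simp: carrier_corestriction[OF Q])
    then show "fmap ?T Q S (compose (carrier Q) v u) y = fmap ?T R S v (fmap ?T Q R u y)"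
      using corestriction_map[OF Q S compose_graded_hom[OF Q u v]] corestriction_map[OF Q R u]
        corestriction_map[OF R S v] graded_homD(3)[OF u] by (simp add: compose_def)
  qed
qed

lemma extension_hom:
  assumes R: "is_graded_ring F R" and S: "is_graded_ring F S" and u: "u \<in> graded_hom F R S"
  shows "u \<in> graded_hom G (extension F \<phi> R) (extension F \<phi> S)"
proof -
  have "u x \<in> piece (extension F \<phi> S) g" if "g \<in> carrier G" "x \<in> piece (extension F \<phi> R) g" for g x
    using that graded_homD(4)[OF u]
      graded_hom_zero[OF u graded_ring_cring[OF R] graded_ring_cring[OF S]]
    by (cases "g \<in> \<phi> ` carrier F") auto
  then show ?thesis
    using graded_homD(1,2)[OF u] by (auto simp: graded_hom_def ring_hom_def)
qed

lemma extension_is_functor: "is_functor (Ann F) (Ann G) (extension_functor F \<phi>)"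
  by (rule Ann_functorI)
    (simp_all add: extension_functor_def extension_graded extension_hom compose_def)

lemma hom_restriction_closed:
  assumes R: "is_graded_ring G R" and S: "is_graded_ring G S" and u: "u \<in> graded_hom G R S"
    and x: "x \<in> carrier (restriction F \<phi> R)"
  shows "u x \<in> carrier (restriction F \<phi> S)"
proof -
  interpret u: ring_hom_cring R S u
    by (rule graded_hom_ring_hom_cring[OF u graded_ring_cring[OF R] graded_ring_cring[OF S]])
  from x obtain A c where A: "finite A" "A \<subseteq> carrier F" "\<forall>f\<in>A. c f \<in> piece R (\<phi> f)"
    and x: "x = finsum R c A"
    unfolding restriction_carrier_sums[OF R] by blast
  have "c f \<in> carrier R" if "f \<in> A" for f
    using A that graded_ring_piece_carrier[OF R phi_closed] by blast
  then have "u x = finsum S (u \<circ> c) A"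
    unfolding x by (intro u.hom_finsum) auto
  moreover have "\<forall>f\<in>A. (u \<circ> c) f \<in> piece S (\<phi> f)"
    using A graded_homD(4)[OF u] phi_closed by auto
  ultimately show ?thesis
    unfolding restriction_carrier_sums[OF S] using A(1,2) by blast
qed

lemma restriction_is_functor: "is_functor (Ann G) (Ann F) (restriction_functor F \<phi>)"
proof (rule Ann_functorI)
  fix R S :: "('a, 'g) graded_ring" and u
  assume R: "is_graded_ring G R" and S: "is_graded_ring G S" and u: "u \<in> graded_hom G R S"
  interpret R: subring_inclusion "restriction F \<phi> R" R by (rule restriction_inclusion[OF R])
  interpret u: ring_hom_cring R S u
    by (rule graded_hom_ring_hom_cring[OF u graded_ring_cring[OF R] graded_ring_cring[OF S]])
  have "u \<in> ring_hom (restriction F \<phi> R) (restriction F \<phi> S)"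
    using R.carrier_subset hom_restriction_closed[OF R S u] by (intro ring_hom_memI) auto
  then show "fmap (restriction_functor F \<phi>) R S u \<in>
      graded_hom F (fobj (restriction_functor F \<phi>) R) (fobj (restriction_functor F \<phi>) S)"
    unfolding restriction_functor_def functor_data.simps
    using graded_homD(4)[OF u] phi_closed
    by (intro restrict_graded_hom restriction_graded[OF R]) auto
next
  fix R :: "('a, 'g) graded_ring" and x
  assume R: "is_graded_ring G R" and x: "x \<in> carrier (fobj (restriction_functor F \<phi>) R)"
  interpret R: subring_inclusion "restriction F \<phi> R" R by (rule restriction_inclusion[OF R])
  show "fmap (restriction_functor F \<phi>) R R (\<lambda>x\<in>carrier R. x) x = x"
    using x R.carrier_subset by (simp add: restriction_functor_def)
next
  fix Q R S :: "('a, 'g) graded_ring" and u v x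
  assume Q: "is_graded_ring G Q" and R: "is_graded_ring G R" and u: "u \<in> graded_hom G Q R"
    and x: "x \<in> carrier (fobj (restriction_functor F \<phi>) Q)"
  interpret Q: subring_inclusion "restriction F \<phi> Q" Q by (rule restriction_inclusion[OF Q])
  show "fmap (restriction_functor F \<phi>) Q S (compose (carrier Q) v u) x =
      fmap (restriction_functor F \<phi>) R S v (fmap (restriction_functor F \<phi>) Q R u x)"
    using x Q.carrier_subset hom_restriction_closed[OF Q R u]
    by (simp add: restriction_functor_def compose_def)
qed (simp add: restriction_functor_def restriction_graded)

section \<open>Units, counits and adjunctions\<close>

lemma carrier_restriction_extension:
  assumes "is_graded_ring F S"
  shows "carrier (restriction F \<phi> (extension F \<phi> S)) = carrier S"
proof -
  let ?E = "extension F \<phi> S"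
  interpret E: graded_cring ?E G
    by (rule graded_cringI[OF G.is_group extension_graded[OF assms]])
  have "component G ?E g x = \<zero>\<^bsub>S\<^esub>" if "x \<in> carrier S" "g \<in> carrier G - \<phi> ` carrier F" for g x
    using E.component_piece[of x g] that by simp
  then show ?thesis by (auto simp: restriction_carrier[OF extension_graded[OF assms]])
qed

lemma carrier_corestriction_extension:
  assumes "is_graded_ring F S"
  shows "carrier (corestriction F G \<phi> (extension F \<phi> S)) = carrier S"
  using alpha_extension[OF assms] by (force simp: carrier_corestriction[OF extension_graded[OF assms]])

lemma restriction_extension:
  assumes "is_graded_ring F S"
  shows "same_graded_ring F (restriction F \<phi> (extension F \<phi> S)) S"
  by (simp add: same_graded_ring_def carrier_restriction_extension[OF assms])

lemma piece_corestriction_extension: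
  assumes "is_graded_ring F S" "f \<in> carrier F"
  shows "piece (corestriction F G \<phi> (extension F \<phi> S)) f = piece S f"
  using assms alpha_extension[OF assms(1)] graded_ring_piece_carrier[OF assms] by force

lemma corestriction_extension:
  assumes S: "is_graded_ring F S"
  shows "same_graded_ring F (corestriction F G \<phi> (extension F \<phi> S)) S"
proof -
  let ?C = "corestriction F G \<phi> (extension F \<phi> S)" and ?\<alpha> = "alpha F G \<phi> (extension F \<phi> S)"
  interpret S: cring S using S by (rule graded_ring_cring)
  interpret a: ring_hom_cring "extension F \<phi> S" ?C ?\<alpha>
    by (rule alpha_ring_hom_cring[OF extension_graded[OF S]])
  note \<alpha> = alpha_extension[OF S]
  have "x \<otimes>\<^bsub>?C\<^esub> y = x \<otimes>\<^bsub>S\<^esub> y" "x \<oplus>\<^bsub>?C\<^esub> y = x \<oplus>\<^bsub>S\<^esub> y"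
    if "x \<in> carrier S" "y \<in> carrier S" for x y
    using a.hom_mult[of x y] a.hom_add[of x y] that by (simp_all add: \<alpha>)
  moreover have "\<one>\<^bsub>?C\<^esub> = \<one>\<^bsub>S\<^esub>" "\<zero>\<^bsub>?C\<^esub> = \<zero>\<^bsub>S\<^esub>"
    using a.hom_one a.hom_zero by (simp_all add: \<alpha>)
  ultimately show ?thesis
    using carrier_corestriction_extension[OF S] piece_corestriction_extension[OF S]
    by (simp add: same_graded_ring_def)
qed

text \<open>In degrees outside the image of \<open>\<phi>\<close> the target is zero, and there \<open>alpha\<close> vanishes because
  these pieces lie in the corestriction ideal.\<close>
lemma alpha_graded_hom:
  assumes R: "is_graded_ring G R"
  shows "alpha F G \<phi> R \<in> graded_hom G R (extension F \<phi> (corestriction F G \<phi> R))"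
proof -
  let ?E = "extension F \<phi> (corestriction F G \<phi> R)"
  have "restrict (alpha F G \<phi> R) (carrier R) \<in> graded_hom G R ?E"
  proof (rule restrict_graded_hom[OF R])
    show "alpha F G \<phi> R \<in> ring_hom R ?E"
      using alpha_ring_hom[OF R] by (simp add: ring_hom_def)
    show "alpha F G \<phi> R x \<in> piece ?E g" if g: "g \<in> carrier G" and x: "x \<in> piece R g" for g x
    proof (cases "g \<in> \<phi> ` carrier F")
      case True
      then show ?thesis using x by auto
    next
      case False
      then show ?thesis
        using alpha_eq_zero_iff[OF R graded_ring_piece_carrier[OF R g x]]
          corestriction_ideal(2)[OF R, of g] g x by auto
    qed
  qed
  moreover have "restrict (alpha F G \<phi> R) (carrier R) = alpha F G \<phi> R"
    by (simp add: alpha_def projection_def restrict_def fun_eq_iff)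
  ultimately show ?thesis by simp
qed

lemma inclusion_graded_hom:
  assumes R: "is_graded_ring G R"
  shows "inclusion F \<phi> R \<in> graded_hom G (extension F \<phi> (restriction F \<phi> R)) R"
  unfolding inclusion_def
proof (rule restrict_graded_hom[OF extension_graded[OF restriction_graded[OF R]]])
  interpret graded_cring R G by (rule graded_cringI[OF G.is_group R])
  interpret R: subring_inclusion "restriction F \<phi> R" R by (rule restriction_inclusion[OF R])
  show "(\<lambda>x. x) \<in> ring_hom (extension F \<phi> (restriction F \<phi> R)) R"
    using R.carrier_subset by (auto simp: ring_hom_def)
  show "x \<in> piece R g"
    if "g \<in> carrier G" "x \<in> piece (extension F \<phi> (restriction F \<phi> R)) g" for g x
    using that piece_zero by (cases "g \<in> \<phi> ` carrier F") auto
qed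

lemma identity_counit_graded_hom:
  assumes "is_graded_ring F S"
  shows "identity_map S \<in> graded_hom F (corestriction F G \<phi> (extension F \<phi> S)) S"
  using same_graded_ring_identity(1)[OF corestriction_graded[OF extension_graded[OF assms]] assms
      corestriction_extension[OF assms]]
  by (simp add: identity_map_def carrier_corestriction_extension[OF assms])

lemma identity_unit_graded_hom:
  assumes "is_graded_ring F S"
  shows "identity_map S \<in> graded_hom F S (restriction F \<phi> (extension F \<phi> S))"
  using same_graded_ring_identity(2)[OF restriction_graded[OF extension_graded[OF assms]] assms
      restriction_extension[OF assms]]
  by (simp add: identity_map_def carrier_restriction_extension[OF assms])

text \<open>Every element of a corestriction has the form \<open>alpha R x\<close>. With the equation for induced
  maps, naturality and the triangle identities reduce to \<open>alpha\<close> being the identity on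
  extensions.\<close>
lemma corestriction_extension_adjunction:
  "adjunction (Ann G) (Ann F) (corestriction_functor F G \<phi>) (extension_functor F \<phi>)
    (alpha F G \<phi>) identity_map"
proof (rule Ann_adjunctionI[OF corestriction_is_functor extension_is_functor])
  have L: "fobj (corestriction_functor F G \<phi>) = corestriction F G \<phi>"
    by (simp add: corestriction_functor_def)
  have M: "fobj (extension_functor F \<phi>) = extension F \<phi>" "fmap (extension_functor F \<phi>) R S u = u"
    for R S u by (simp_all add: extension_functor_def)
  note LM = L M
  show "alpha F G \<phi> R \<in> graded_hom G R
      (fobj (extension_functor F \<phi>) (fobj (corestriction_functor F G \<phi>) R))"
    if "is_graded_ring G R" for R
    using alpha_graded_hom[OF that] by (simp add: LM)
  show "identity_map S \<in> graded_hom F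
      (fobj (corestriction_functor F G \<phi>) (fobj (extension_functor F \<phi>) S)) S"
    if "is_graded_ring F S" for S
    using identity_counit_graded_hom[OF that] by (simp add: LM)
  show "fmap (extension_functor F \<phi>) (fobj (corestriction_functor F G \<phi>) R)
      (fobj (corestriction_functor F G \<phi>) S) (fmap (corestriction_functor F G \<phi>) R S u)
      (alpha F G \<phi> R x) = alpha F G \<phi> S (u x)"
    if "is_graded_ring G R" "is_graded_ring G S" "u \<in> graded_hom G R S" "x \<in> carrier R" for R S u x
    using corestriction_map[OF that] by (simp add: M)
  show "u (identity_map R x) = identity_map S (fmap (corestriction_functor F G \<phi>)
      (fobj (extension_functor F \<phi>) R) (fobj (extension_functor F \<phi>) S)
      (fmap (extension_functor F \<phi>) R S u) x)"
    if R: "is_graded_ring F R" and S: "is_graded_ring F S" and u: "u \<in> graded_hom F R S"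
      and "x \<in> carrier (fobj (corestriction_functor F G \<phi>) (fobj (extension_functor F \<phi>) R))"
    for R S u x
  proof -
    have x: "x \<in> carrier R" using that(4) by (simp add: LM carrier_corestriction_extension[OF R])
    then have "fmap (corestriction_functor F G \<phi>) (extension F \<phi> R) (extension F \<phi> S) u x = u x"
      using corestriction_map[OF extension_graded[OF R] extension_graded[OF S]
          extension_hom[OF R S u], of x] graded_homD(3)[OF u]
      by (simp add: alpha_extension[OF R] alpha_extension[OF S])
    then show ?thesis
      using x graded_homD(3)[OF u] by (simp add: M identity_map_def)
  qed
  show "identity_map (fobj (corestriction_functor F G \<phi>) R) (fmap (corestriction_functor F G \<phi>) R
      (fobj (extension_functor F \<phi>) (fobj (corestriction_functor F G \<phi>) R)) (alpha F G \<phi> R) y) = y"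
    if R: "is_graded_ring G R" and y: "y \<in> carrier (fobj (corestriction_functor F G \<phi>) R)" for R y
  proof -
    note C = corestriction_graded[OF R]
    from y obtain x where x: "x \<in> carrier R" "y = alpha F G \<phi> R x"
      by (auto simp: L carrier_corestriction[OF R])
    show ?thesis
      using corestriction_map[OF R extension_graded[OF C] alpha_graded_hom[OF R] x(1)]
        alpha_extension[OF C, of y] x y by (simp add: LM identity_map_def)
  qed
  show "fmap (extension_functor F \<phi>) (fobj (corestriction_functor F G \<phi>)
      (fobj (extension_functor F \<phi>) S)) S (identity_map S)
      (alpha F G \<phi> (fobj (extension_functor F \<phi>) S) x) = x"
    if "is_graded_ring F S" "x \<in> carrier (fobj (extension_functor F \<phi>) S)" for S x
    using that by (simp add: M alpha_extension identity_map_def)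
qed

text \<open>All maps involved act as the identity or as the given morphism, so only membership in
  the respective carriers is at stake.\<close>
lemma extension_restriction_adjunction:
  "adjunction (Ann F) (Ann G) (extension_functor F \<phi>) (restriction_functor F \<phi>)
    identity_map (inclusion F \<phi>)"
proof (rule Ann_adjunctionI[OF extension_is_functor restriction_is_functor])
  have LM: "fobj (extension_functor F \<phi>) = extension F \<phi>" "fmap (extension_functor F \<phi>) R S u = u"
    "fobj (restriction_functor F \<phi>) = restriction F \<phi>"
    "fmap (restriction_functor F \<phi>) R' S' u = restrict u (carrier (restriction F \<phi> R'))"
    for R S R' S' u by (simp_all add: extension_functor_def restriction_functor_def)
  show "identity_map S \<in> graded_hom F S
      (fobj (restriction_functor F \<phi>) (fobj (extension_functor F \<phi>) S))"
    if "is_graded_ring F S" for S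
    using identity_unit_graded_hom[OF that] by (simp add: LM)
  show "inclusion F \<phi> R \<in> graded_hom G
      (fobj (extension_functor F \<phi>) (fobj (restriction_functor F \<phi>) R)) R"
    if "is_graded_ring G R" for R
    using inclusion_graded_hom[OF that] by (simp add: LM)
  show "fmap (restriction_functor F \<phi>) (fobj (extension_functor F \<phi>) R)
      (fobj (extension_functor F \<phi>) S) (fmap (extension_functor F \<phi>) R S u)
      (identity_map R x) = identity_map S (u x)"
    if "is_graded_ring F R" "is_graded_ring F S" "u \<in> graded_hom F R S" "x \<in> carrier R" for R S u x
    using that graded_homD(3)[OF that(3,4)]
    by (simp add: LM identity_map_def carrier_restriction_extension)
  show "u (inclusion F \<phi> R x) = inclusion F \<phi> S (fmap (extension_functor F \<phi>)
      (fobj (restriction_functor F \<phi>) R) (fobj (restriction_functor F \<phi>) S)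
      (fmap (restriction_functor F \<phi>) R S u) x)"
    if "is_graded_ring G R" "is_graded_ring G S" "u \<in> graded_hom G R S"
      "x \<in> carrier (fobj (extension_functor F \<phi>) (fobj (restriction_functor F \<phi>) R))" for R S u x
    using that hom_restriction_closed[OF that(1-3), of x] by (simp add: LM inclusion_def)
  show "inclusion F \<phi> (fobj (extension_functor F \<phi>) S) (fmap (extension_functor F \<phi>) S
      (fobj (restriction_functor F \<phi>) (fobj (extension_functor F \<phi>) S)) (identity_map S) x) = x"
    if "is_graded_ring F S" "x \<in> carrier (fobj (extension_functor F \<phi>) S)" for S x
    using that by (simp add: LM inclusion_def identity_map_def carrier_restriction_extension)
  show "fmap (restriction_functor F \<phi>) (fobj (extension_functor F \<phi>)
      (fobj (restriction_functor F \<phi>) R)) R (inclusion F \<phi> R)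
      (identity_map (fobj (restriction_functor F \<phi>) R) x) = x"
    if "is_graded_ring G R" "x \<in> carrier (fobj (restriction_functor F \<phi>) R)" for R x
    using that carrier_restriction_extension[OF restriction_graded[OF that(1)]]
    by (simp add: LM inclusion_def identity_map_def)
qed

end

theorem mainTheorem1:
  fixes F :: "('f, 'c) monoid_scheme" and G :: "('g, 'd) monoid_scheme" and \<phi> :: "'f \<Rightarrow> 'g"
  assumes "comm_group F" and "comm_group G" and "\<phi> \<in> mon F G"
  shows
    "adjunction (Ann G :: (('a, 'g) graded_ring, 'a \<Rightarrow> 'a) category) (Ann F)
       (corestriction_functor F G \<phi>) (extension_functor F \<phi>) (alpha F G \<phi>) identity_map \<and>
     adjunction (Ann F :: (('a, 'f) graded_ring, 'a \<Rightarrow> 'a) category) (Ann G)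
       (extension_functor F \<phi>) (restriction_functor F \<phi>) identity_map (inclusion F \<phi>) \<and>
     (\<forall>S :: ('a, 'f) graded_ring. is_graded_ring F S \<longrightarrow>
        same_graded_ring F (corestriction F G \<phi> (extension F \<phi> S)) S \<and>
        same_graded_ring F (restriction F \<phi> (extension F \<phi> S)) S) \<and>
     (\<forall>R :: ('a, 'g) graded_ring. is_graded_ring G R \<longrightarrow>
        alpha F G \<phi> R ` carrier R = carrier (extension F \<phi> (corestriction F G \<phi> R)) \<and>
        inj_on (inclusion F \<phi> R) (carrier (extension F \<phi> (restriction F \<phi> R))))"
proof -
  interpret group_mono F G \<phi>
    using assms by (simp add: group_mono_def group_mono_axioms_def comm_group_def)
  have "inj_on (inclusion F \<phi> R) (carrier (extension F \<phi> (restriction F \<phi> R)))"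
    for R :: "('a, 'g) graded_ring"
    by (auto simp: inclusion_def inj_on_def)
  then show ?thesis
    using corestriction_extension_adjunction extension_restriction_adjunction
    by (intro conjI allI impI)
      (simp_all add: corestriction_extension restriction_extension carrier_corestriction)
qed

end
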